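(* Let $\Gamma$ be a finite undirected simple graph with vertex set $V=\{x_1,\dots,x_n\}$, let $V_{n-1}$ be the set of vertices of degree $n-1$, and let $r=|V_{n-1}|$. If $r<n$, then \[\mathrm{Spec}_R(G_\Gamma)=\mathrm{Spec}_R(\mathbb{Z}^r)\cdot\mathrm{Spec}_R\big(G_{\Gamma(V\setminus V_{n-1})}\big).\]
   Context: For a finite undirected simple graph $\Gamma$ with vertex set $\{x_1,\dots,x_n\}$ and edge set $E$, the group $G_\Gamma$ is defined by the presentation with generators $x_1,\dots,x_n$ and $y_{i,j}$ for each pair $i<j$ with $x_ix_j\notin E$, and relations $[x_j,x_i]=1$ if $x_ix_j\in E$; $[x_j,x_i]=y_{i,j}$ if $x_ix_j\notin E$ and $i<j$; and $[x_l,y_{i,j}]=1$ for all $l$ and all such $y_{i,j}$. For $V'\subseteq V$, $\Gamma(V')$ denotes the induced subgraph on $V'$. For a group $G$ and $\varphi\in\mathrm{Aut}(G)$, $R(\varphi)\in\mathbb{N}_0\cup\{\infty\}$ is the number of classes of the equivalence relation $a\sim b\iff a=cb\varphi(c)^{-1}$ for some $c\in G$, and $\mathrm{Spec}_R(G)=\{R(\varphi):\varphi\in\mathrm{Aut}(G)\}$ ($\mathbb{N}_0$ = positive integers). For $M,M'\subseteq\mathbb{N}_0\cup\{\infty\}$, $M\cdot M'=\{mm': m\in M, m'\in M'\}$, with $\infty\cdot m=m\cdot\infty=\infty$. *)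

theory Defs
  imports "HOL-Algebra.Algebra" "HOL-Library.Extended_Nat"
begin

text \<open>A word over generators of type 'g is a list of letters (b, g); (True, g) stands
  for g and (False, g) for its inverse.\<close>

type_synonym 'g word = "(bool \<times> 'g) list"

definition word_inv :: "'g word \<Rightarrow> 'g word" where
  "word_inv w = rev (map (\<lambda>(b, g). (\<not> b, g)) w)"

definition comm_word :: "'g word \<Rightarrow> 'g word \<Rightarrow> 'g word" where
  "comm_word a b = word_inv a @ word_inv b @ a @ b"

inductive pres_eq :: "'g set \<Rightarrow> 'g word set \<Rightarrow> 'g word \<Rightarrow> 'g word \<Rightarrow> bool"
  for S :: "'g set" and R :: "'g word set" where
  pe_refl: "pres_eq S R w w"
| pe_sym: "pres_eq S R u w \<Longrightarrow> pres_eq S R w u"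
| pe_trans: "pres_eq S R u v \<Longrightarrow> pres_eq S R v w \<Longrightarrow> pres_eq S R u w"
| pe_cancel: "g \<in> S \<Longrightarrow> pres_eq S R (u @ [(b, g), (\<not> b, g)] @ w) (u @ w)"
| pe_rel: "r \<in> R \<Longrightarrow> pres_eq S R (u @ r @ w) (u @ w)"

definition pres_class :: "'g set \<Rightarrow> 'g word set \<Rightarrow> 'g word \<Rightarrow> 'g word set" where
  "pres_class S R w = {w'. w' \<in> lists (UNIV \<times> S) \<and> pres_eq S R w w'}"

definition presented_group :: "'g set \<Rightarrow> 'g word set \<Rightarrow> ('g word set) monoid" where
  "presented_group S R =
     \<lparr> carrier = pres_class S R ` lists (UNIV \<times> S),
       monoid.mult = (\<lambda>A B. {w. w \<in> lists (UNIV \<times> S) \<and>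
                             (\<exists>a\<in>A. \<exists>b\<in>B. pres_eq S R (a @ b) w)}),
       one = pres_class S R [] \<rparr>"

text \<open>Vertices are natural numbers in a finite set V (x_i is vertex i, ordered by the
  order on nat); E is the (symmetric, irreflexive) adjacency relation.\<close>

datatype gen = GX nat | GY nat nat

definition GGamma_gens :: "nat set \<Rightarrow> (nat \<Rightarrow> nat \<Rightarrow> bool) \<Rightarrow> gen set" where
  "GGamma_gens V E = GX ` V \<union> {GY i j | i j. i \<in> V \<and> j \<in> V \<and> i < j \<and> \<not> E i j}"

definition GGamma_rels :: "nat set \<Rightarrow> (nat \<Rightarrow> nat \<Rightarrow> bool) \<Rightarrow> gen word set" where
  "GGamma_rels V E =
     {comm_word [(True, GX j)] [(True, GX i)] | i j. i \<in> V \<and> j \<in> V \<and> E i j}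
   \<union> {comm_word [(True, GX j)] [(True, GX i)] @ [(False, GY i j)]
        | i j. i \<in> V \<and> j \<in> V \<and> i < j \<and> \<not> E i j}
   \<union> {comm_word [(True, GX l)] [(True, GY i j)]
        | l i j. l \<in> V \<and> i \<in> V \<and> j \<in> V \<and> i < j \<and> \<not> E i j}"

definition GGamma :: "nat set \<Rightarrow> (nat \<Rightarrow> nat \<Rightarrow> bool) \<Rightarrow> (gen word set) monoid" where
  "GGamma V E = presented_group (GGamma_gens V E) (GGamma_rels V E)"

definition twisted_conj :: "('a, 'b) monoid_scheme \<Rightarrow> ('a \<Rightarrow> 'a) \<Rightarrow> ('a \<times> 'a) set" where
  "twisted_conj G \<phi> = {(a, b). a \<in> carrier G \<and> b \<in> carrier G \<and>
      (\<exists>c\<in>carrier G. a = c \<otimes>\<^bsub>G\<^esub> b \<otimes>\<^bsub>G\<^esub> inv\<^bsub>G\<^esub> (\<phi> c))}"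

definition reidemeister :: "('a, 'b) monoid_scheme \<Rightarrow> ('a \<Rightarrow> 'a) \<Rightarrow> enat" where
  "reidemeister G \<phi> =
     (let C = carrier G // twisted_conj G \<phi> in if finite C then enat (card C) else \<infinity>)"

definition spec_R :: "('a, 'b) monoid_scheme \<Rightarrow> enat set" where
  "spec_R G = {reidemeister G \<phi> | \<phi>. \<phi> \<in> iso G G}"

definition set_times_inf :: "enat set \<Rightarrow> enat set \<Rightarrow> enat set" where
  "set_times_inf M M' =
     {if m = \<infinity> \<or> m' = \<infinity> then \<infinity> else m * m' | m m'. m \<in> M \<and> m' \<in> M'}"

definition Zpow :: "nat \<Rightarrow> (nat \<Rightarrow> int) monoid" where
  "Zpow r = product_group {..<r} (\<lambda>_. integer_group)"

definition graph_degree :: "nat set \<Rightarrow> (nat \<Rightarrow> nat \<Rightarrow> bool) \<Rightarrow> nat \<Rightarrow> nat" where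
  "graph_degree V E v = card {u \<in> V. E v u}"

end

theory Submission
  imports Defs
begin

text \<open>Let \<open>U\<close> be the set of vertices adjacent to all others and \<open>W\<close> its complement. The group of the graph is
  \<open>G = \<int>\<^sup>U \<times> H\<close> with \<open>H\<close> the group of the subgraph on \<open>W\<close>; the commutator subgroup of both \<open>G\<close> and \<open>H\<close> is the
  free abelian group \<open>Y\<close> on the \<open>y\<^sub>i\<^sub>j\<close>, which is the centre of \<open>H\<close> because no vertex of \<open>W\<close> is joined to all others of \<open>W\<close>.
  An automorphism \<open>\<phi>\<close> of \<open>G\<close> preserves \<open>Y\<close> and the centre \<open>\<int>\<^sup>U \<times> Y\<close>, so it induces automorphisms \<open>\<delta>\<close> of
  \<open>\<int>\<^sup>U\<close> (the centre modulo \<open>Y\<close>) and \<open>\<psi>\<close> of \<open>H\<close> (the \<open>H\<close>-component of \<open>\<phi>\<close> on \<open>H\<close>). Reidemeister numbers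
  are multiplicative in central extensions with abelian quotient on which the induced map has no nontrivial fixed point, and
  a nontrivial fixed point on a free abelian group of finite rank makes the number infinite. Splitting
  \<open>G\<close> along \<open>Y\<close>, \<open>\<int>\<^sup>U\<close>, \<open>\<int>\<^sup>W\<close> and \<open>H\<close> along \<open>Y\<close>, \<open>\<int>\<^sup>W\<close> then gives \<open>R(\<phi>) = R(\<delta>) R(\<psi>)\<close>.\<close>

section \<open>Reidemeister numbers\<close>

definition ecard :: "'a set \<Rightarrow> enat" where
  "ecard A = (if finite A then enat (card A) else \<infinity>)"

lemma ecard_Times:
  assumes "A \<noteq> {}" "B \<noteq> {}"
  shows "ecard (A \<times> B) = ecard A * ecard B"
  using assms by (auto simp: ecard_def finite_cartesian_product_iff card_cartesian_product zero_enat_def)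

lemma ecard_image: "inj_on f A \<Longrightarrow> ecard (f ` A) = ecard A"
  by (simp add: ecard_def card_image finite_image_iff)

lemma ecard_nonzero: "A \<noteq> {} \<Longrightarrow> ecard A \<noteq> 0"
  by (auto simp: ecard_def zero_enat_def)

text \<open>Clearing the inverse turns twisted conjugacy into an equation between products, which
  homomorphisms carry over directly; all later arguments use this form.\<close>

lemma twisted_conj_iff:
  assumes "group G" "\<phi> \<in> hom G G"
  shows "(a, b) \<in> twisted_conj G \<phi> \<longleftrightarrow> a \<in> carrier G \<and> b \<in> carrier G \<and>
    (\<exists>c\<in>carrier G. a \<otimes>\<^bsub>G\<^esub> \<phi> c = c \<otimes>\<^bsub>G\<^esub> b)"
proof -
  interpret group G by fact
  show ?thesis
    unfolding twisted_conj_def using hom_in_carrier[OF assms(2)]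
    by (simp add: Bex_def) (metis inv_solve_right m_closed)
qed

lemma equiv_twisted_conj:
  fixes G (structure)
  assumes "group G" "\<phi> \<in> hom G G"
  shows "equiv (carrier G) (twisted_conj G \<phi>)"
proof -
  interpret group G by fact
  interpret group_hom G G \<phi>
    using assms by (simp add: group_hom_def group_hom_axioms_def)
  note iff = twisted_conj_iff[OF assms]
  show ?thesis
  proof (rule equivI)
    show "twisted_conj G \<phi> \<subseteq> carrier G \<times> carrier G"
      by (auto simp: twisted_conj_def)
    show "refl_on (carrier G) (twisted_conj G \<phi>)"
      by (rule refl_onI) (auto simp: iff intro!: bexI[of _ \<one>])
    show "sym (twisted_conj G \<phi>)"
    proof (rule symI)
      fix a b assume "(a, b) \<in> twisted_conj G \<phi>"
      then obtain c where c: "a \<in> carrier G" "b \<in> carrier G" "c \<in> carrier G"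
        and eq: "a \<otimes> \<phi> c = c \<otimes> b" by (auto simp: iff)
      have "a = c \<otimes> b \<otimes> inv (\<phi> c)" using c eq by (metis inv_solve_right m_closed hom_closed)
      then have "inv c \<otimes> a = b \<otimes> \<phi> (inv c)"
        using c by (simp add: m_assoc[symmetric])
      then show "(b, a) \<in> twisted_conj G \<phi>"
        using c by (auto simp: iff intro!: bexI[of _ "inv c"])
    qed
    show "trans (twisted_conj G \<phi>)"
    proof (rule transI)
      fix x y z assume "(x, y) \<in> twisted_conj G \<phi>" "(y, z) \<in> twisted_conj G \<phi>"
      then obtain c d where c: "x \<in> carrier G" "y \<in> carrier G" "z \<in> carrier G" "c \<in> carrier G" "d \<in> carrier G"
        and eq: "x \<otimes> \<phi> c = c \<otimes> y" "y \<otimes> \<phi> d = d \<otimes> z" by (auto simp: iff)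
      have "x \<otimes> \<phi> (c \<otimes> d) = (x \<otimes> \<phi> c) \<otimes> \<phi> d" using c by (simp add: m_assoc)
      also have "\<dots> = c \<otimes> (y \<otimes> \<phi> d)" using c by (simp add: eq(1) m_assoc)
      also have "\<dots> = (c \<otimes> d) \<otimes> z" using c by (simp add: eq(2) m_assoc)
      finally show "(x, z) \<in> twisted_conj G \<phi>"
        using c by (auto simp: iff intro!: bexI[of _ "c \<otimes> d"])
    qed
  qed
qed

text \<open>One representative per class. Counting representatives instead of classes allows those
  of an extension to be assembled from those of its kernel and its quotient.\<close>

definition transversal :: "('a, 'b) monoid_scheme \<Rightarrow> ('a \<Rightarrow> 'a) \<Rightarrow> 'a set \<Rightarrow> bool" where
  "transversal G \<phi> T \<longleftrightarrow> T \<subseteq> carrier G \<and>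
     (\<forall>g\<in>carrier G. \<exists>t\<in>T. (g, t) \<in> twisted_conj G \<phi>) \<and>
     (\<forall>s\<in>T. \<forall>t\<in>T. (s, t) \<in> twisted_conj G \<phi> \<longrightarrow> s = t)"

lemma reidemeister_transversal:
  assumes "group G" "\<phi> \<in> hom G G" "transversal G \<phi> T"
  shows "reidemeister G \<phi> = ecard T"
proof -
  note eq = equiv_twisted_conj[OF assms(1,2)]
  let ?r = "twisted_conj G \<phi>"
  have T: "T \<subseteq> carrier G" "\<And>g. g \<in> carrier G \<Longrightarrow> \<exists>t\<in>T. (g, t) \<in> ?r"
    "\<And>s t. \<lbrakk>s \<in> T; t \<in> T; (s, t) \<in> ?r\<rbrakk> \<Longrightarrow> s = t"
    using assms(3) by (auto simp: transversal_def)
  have "inj_on (\<lambda>t. ?r `` {t}) T"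
    by (rule inj_onI) (metis T(1,3) eq eq_equiv_class subsetD)
  moreover have "(\<lambda>t. ?r `` {t}) ` T = carrier G // ?r"
  proof (intro equalityI subsetI)
    fix C assume "C \<in> carrier G // ?r"
    then obtain g where g: "g \<in> carrier G" "C = ?r `` {g}" by (auto elim: quotientE)
    then obtain t where "t \<in> T" "(g, t) \<in> ?r" using T(2) by blast
    then show "C \<in> (\<lambda>t. ?r `` {t}) ` T" using g equiv_class_eq[OF eq] by blast
  qed (use T(1) in \<open>auto intro: quotientI\<close>)
  ultimately show ?thesis
    unfolding reidemeister_def Let_def using ecard_image by (metis ecard_def)
qed

lemma ex_transversal:
  assumes "group G" "\<phi> \<in> hom G G"
  obtains T where "transversal G \<phi> T"
proof -
  note eq = equiv_twisted_conj[OF assms]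
  let ?r = "twisted_conj G \<phi>"
  let ?s = "\<lambda>g. SOME t. (g, t) \<in> ?r"
  have s: "(g, ?s g) \<in> ?r" if "g \<in> carrier G" for g
    by (rule someI) (rule refl_onD[OF _ that], use eq in \<open>simp add: equiv_def\<close>)
  \<comment> \<open>Related elements have the same set of candidates, so the choice operator returns
    the same representative for both.\<close>
  have s_eq: "?s g = ?s h" if "(g, h) \<in> ?r" for g h
  proof -
    have "(g, t) \<in> ?r \<longleftrightarrow> (h, t) \<in> ?r" for t
      using that eq by (meson equiv_def symE transE)
    then show ?thesis by simp
  qed
  have "transversal G \<phi> (?s ` carrier G)"
    unfolding transversal_def
  proof (intro conjI ballI impI)
    show "?s ` carrier G \<subseteq> carrier G"
      using s by (auto simp: twisted_conj_def)
    show "\<exists>t\<in>?s ` carrier G. (g, t) \<in> ?r" if "g \<in> carrier G" for g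
      using s[OF that] that by blast
    fix x y assume "x \<in> ?s ` carrier G" "y \<in> ?s ` carrier G" "(x, y) \<in> ?r"
    then obtain g h where gh: "g \<in> carrier G" "h \<in> carrier G" "x = ?s g" "y = ?s h" by auto
    have "(g, h) \<in> ?r"
      using s[OF gh(1)] s[OF gh(2)] \<open>(x, y) \<in> ?r\<close> eq gh(3,4)
      by (metis equiv_def symD transD)
    then show "x = y" using s_eq gh by simp
  qed
  then show ?thesis by (rule that)
qed

lemma transversal_nonempty:
  assumes "group G" "transversal G \<phi> T"
  shows "T \<noteq> {}"
  using assms group.is_monoid monoid.one_closed unfolding transversal_def by fastforce

lemma reidemeister_nonzero:
  assumes "group G" "\<phi> \<in> hom G G"
  shows "reidemeister G \<phi> \<noteq> 0"
  using assms ex_transversal ecard_nonzero reidemeister_transversal transversal_nonempty by metis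

text \<open>By equivariance \<open>\<pi>\<close> sends twisted classes into twisted classes, and
  being onto it reaches every class of \<open>Q\<close>. So \<open>G\<close> has at least as many
  classes as \<open>Q\<close>.\<close>

lemma reidemeister_quotient_infinite:
  assumes "group G" "group Q" and \<phi>: "\<phi> \<in> hom G G" and \<kappa>: "\<kappa> \<in> hom Q Q"
    and \<pi>: "\<pi> \<in> hom G Q" "\<pi> ` carrier G = carrier Q"
    and eqv: "\<And>g. g \<in> carrier G \<Longrightarrow> \<pi> (\<phi> g) = \<kappa> (\<pi> g)"
    and inf: "reidemeister Q \<kappa> = \<infinity>"
  shows "reidemeister G \<phi> = \<infinity>"
proof -
  obtain T where T: "transversal G \<phi> T" using ex_transversal assms by blast
  obtain T' where T': "transversal Q \<kappa> T'" using ex_transversal assms by blast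
  have inf': "infinite T'"
    using inf reidemeister_transversal[OF assms(2) \<kappa> T'] by (auto simp: ecard_def split: if_splits)
  let ?r = "twisted_conj Q \<kappa>"
  have eq: "equiv (carrier Q) ?r" using assms equiv_twisted_conj by blast
  have ex: "\<exists>t\<in>T. (q, \<pi> t) \<in> ?r" if q: "q \<in> carrier Q" for q
  proof -
    obtain g where g: "g \<in> carrier G" "q = \<pi> g" using q \<pi>(2) by blast
    then obtain t where t: "t \<in> T" "(g, t) \<in> twisted_conj G \<phi>" using T by (auto simp: transversal_def)
    then obtain c where c: "t \<in> carrier G" "c \<in> carrier G" "g \<otimes>\<^bsub>G\<^esub> \<phi> c = c \<otimes>\<^bsub>G\<^esub> t"
      using twisted_conj_iff[OF assms(1) \<phi>] by auto
    have "\<pi> g \<otimes>\<^bsub>Q\<^esub> \<kappa> (\<pi> c) = \<pi> c \<otimes>\<^bsub>Q\<^esub> \<pi> t"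
      using c g \<phi> by (metis \<pi>(1) eqv hom_in_carrier hom_mult)
    then show ?thesis
      using c g t twisted_conj_iff[OF assms(2) \<kappa>] hom_in_carrier[OF \<pi>(1)] by (auto intro!: bexI[of _ t])
  qed
  \<comment> \<open>\<open>f\<close> lifts a class of \<open>Q\<close> to a representative in
    \<open>T\<close> whose image lies in that class. It is injective because the image recovers the
    class.\<close>
  define f where "f q = (SOME t. t \<in> T \<and> (q, \<pi> t) \<in> ?r)" for q
  have f: "f q \<in> T \<and> (q, \<pi> (f q)) \<in> ?r" if "q \<in> T'" for q
  proof -
    have "q \<in> carrier Q" using that T' by (auto simp: transversal_def)
    then have "\<exists>t. t \<in> T \<and> (q, \<pi> t) \<in> ?r" using ex by blast
    then show ?thesis unfolding f_def by (rule someI_ex)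
  qed
  have "inj_on f T'"
  proof (rule inj_onI)
    fix x y assume xy: "x \<in> T'" "y \<in> T'" "f x = f y"
    then have "(x, y) \<in> ?r" using f eq by (metis equiv_def symD transD)
    then show "x = y" using xy T' by (auto simp: transversal_def)
  qed
  moreover have "f ` T' \<subseteq> T" using f by auto
  ultimately have "infinite T" using inf' by (meson inj_on_finite)
  then show ?thesis using reidemeister_transversal[OF assms(1) \<phi> T] by (simp add: ecard_def)
qed

text \<open>The products \<open>s q \<otimes> \<iota> n\<close>, with \<open>s\<close> a
  set-theoretic section of \<open>\<pi>\<close> and with \<open>q\<close>, \<open>n\<close> running
  through representatives for \<open>Q\<close> and \<open>N\<close>, meet every class of
  \<open>G\<close> exactly once. Existence first adjusts the image in \<open>Q\<close>, then the
  remaining factor in \<open>N\<close>. Uniqueness rests on the absence of fixed points: it forces a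
  conjugator between two such products into the central subgroup.\<close>

lemma reidemeister_central_extension:
  assumes "group N" "group G" "comm_group Q"
    and \<iota>: "\<iota> \<in> hom N G" "inj_on \<iota> (carrier N)"
    and \<pi>: "\<pi> \<in> hom G Q" "\<pi> ` carrier G = carrier Q"
    and exact: "\<iota> ` carrier N = kernel G Q \<pi>"
    and central: "\<And>n g. \<lbrakk>n \<in> carrier N; g \<in> carrier G\<rbrakk> \<Longrightarrow> \<iota> n \<otimes>\<^bsub>G\<^esub> g = g \<otimes>\<^bsub>G\<^esub> \<iota> n"
    and \<nu>: "\<nu> \<in> hom N N" and \<phi>: "\<phi> \<in> hom G G" and \<kappa>: "\<kappa> \<in> hom Q Q"
    and eqv: "\<And>n. n \<in> carrier N \<Longrightarrow> \<phi> (\<iota> n) = \<iota> (\<nu> n)"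
      "\<And>g. g \<in> carrier G \<Longrightarrow> \<pi> (\<phi> g) = \<kappa> (\<pi> g)"
    and fix1: "\<And>q. \<lbrakk>q \<in> carrier Q; \<kappa> q = q\<rbrakk> \<Longrightarrow> q = \<one>\<^bsub>Q\<^esub>"
  shows "reidemeister G \<phi> = reidemeister N \<nu> * reidemeister Q \<kappa>"
proof -
  interpret N: group N by fact
  interpret G: group G by fact
  interpret Q: comm_group Q by fact
  interpret \<iota>: group_hom N G \<iota> using \<iota> by unfold_locales
  interpret \<pi>: group_hom G Q \<pi> using \<pi> by unfold_locales
  interpret \<phi>: group_hom G G \<phi> using \<phi> by unfold_locales
  interpret \<nu>: group_hom N N \<nu> using \<nu> by unfold_locales
  interpret \<kappa>: group_hom Q Q \<kappa> using \<kappa> by unfold_locales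
  obtain TN where TN: "transversal N \<nu> TN" using ex_transversal[OF assms(1) \<nu>] by blast
  obtain TQ where TQ: "transversal Q \<kappa> TQ" using ex_transversal[OF Q.is_group \<kappa>] by blast
  have TNc: "\<And>n. n \<in> TN \<Longrightarrow> n \<in> carrier N" and TQc: "\<And>q. q \<in> TQ \<Longrightarrow> q \<in> carrier Q"
    using TN TQ by (auto simp: transversal_def)
  note iffN = twisted_conj_iff[OF assms(1) \<nu>] and iffG = twisted_conj_iff[OF assms(2) \<phi>]
    and iffQ = twisted_conj_iff[OF Q.is_group \<kappa>]
  define s where "s = inv_into (carrier G) \<pi>"
  have s: "s q \<in> carrier G" "\<pi> (s q) = q" if "q \<in> carrier Q" for q
    using that \<pi> by (auto simp: s_def inv_into_into f_inv_into_f)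
  have ker: "\<exists>n\<in>carrier N. g = \<iota> n" if "g \<in> carrier G" "\<pi> g = \<one>\<^bsub>Q\<^esub>" for g
    using that exact by (auto simp: kernel_def)
  have \<pi>\<iota>: "\<pi> (\<iota> n) = \<one>\<^bsub>Q\<^esub>" if "n \<in> carrier N" for n
    using that exact by (auto simp: kernel_def)
  let ?f = "\<lambda>(q, n). s q \<otimes>\<^bsub>G\<^esub> \<iota> n"
  have uniq: "q = q' \<and> n = n'"
    if qn: "q \<in> TQ" "n \<in> TN" "q' \<in> TQ" "n' \<in> TN"
      and tc: "(?f (q, n), ?f (q', n')) \<in> twisted_conj G \<phi>" for q n q' n'
  proof -
    note qn' = TQc[OF qn(1)] TNc[OF qn(2)] TQc[OF qn(3)] TNc[OF qn(4)]
    obtain c where c: "c \<in> carrier G"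
      and eq: "s q \<otimes>\<^bsub>G\<^esub> \<iota> n \<otimes>\<^bsub>G\<^esub> \<phi> c = c \<otimes>\<^bsub>G\<^esub> (s q' \<otimes>\<^bsub>G\<^esub> \<iota> n')"
      using tc by (auto simp: iffG)
    have eqQ: "q \<otimes>\<^bsub>Q\<^esub> \<kappa> (\<pi> c) = \<pi> c \<otimes>\<^bsub>Q\<^esub> q'"
      using arg_cong[OF eq, of \<pi>] c qn' s by (simp add: \<pi>\<iota> eqv)
    then have "(q, q') \<in> twisted_conj Q \<kappa>" using c qn' by (auto simp: iffQ)
    then have q: "q = q'" using qn TQ by (auto simp: transversal_def)
    \<comment> \<open>With \<open>q = q'\<close>, cancelling \<open>q\<close> in the abelian group
      \<open>Q\<close> leaves a fixed point of \<open>\<kappa>\<close>.\<close>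
    have "\<kappa> (\<pi> c) = \<pi> c"
      using eqQ c qn' unfolding q by (metis Q.l_cancel Q.m_comm \<kappa>.hom_closed \<pi>.hom_closed)
    then have "\<pi> c = \<one>\<^bsub>Q\<^esub>" using fix1 c by auto
    then obtain e where e: "e \<in> carrier N" "c = \<iota> e" using ker c by blast
    have "s q \<otimes>\<^bsub>G\<^esub> \<iota> (n \<otimes>\<^bsub>N\<^esub> \<nu> e) = s q \<otimes>\<^bsub>G\<^esub> \<iota> n \<otimes>\<^bsub>G\<^esub> \<phi> c"
      using e qn' s by (simp add: eqv G.m_assoc)
    also have "\<dots> = (c \<otimes>\<^bsub>G\<^esub> s q) \<otimes>\<^bsub>G\<^esub> \<iota> n'" using eq q c qn' s by (simp add: G.m_assoc)
    also have "c \<otimes>\<^bsub>G\<^esub> s q = s q \<otimes>\<^bsub>G\<^esub> \<iota> e" using e qn' s by (simp add: central)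
    also have "\<dots> \<otimes>\<^bsub>G\<^esub> \<iota> n' = s q \<otimes>\<^bsub>G\<^esub> \<iota> (e \<otimes>\<^bsub>N\<^esub> n')" using e qn' s by (simp add: G.m_assoc)
    finally have "\<iota> (n \<otimes>\<^bsub>N\<^esub> \<nu> e) = \<iota> (e \<otimes>\<^bsub>N\<^esub> n')" using e qn' s by simp
    then have "n \<otimes>\<^bsub>N\<^esub> \<nu> e = e \<otimes>\<^bsub>N\<^esub> n'" using e qn' by (simp add: inj_on_eq_iff[OF \<iota>(2)] del: \<iota>.hom_mult)
    then have "(n, n') \<in> twisted_conj N \<nu>" using e qn' by (auto simp: iffN)
    then show ?thesis using q qn TN by (auto simp: transversal_def)
  qed
  have fc: "?f p \<in> carrier G" if "p \<in> TQ \<times> TN" for p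
    using that s TQc TNc by auto
  have "transversal G \<phi> (?f ` (TQ \<times> TN))"
    unfolding transversal_def
  proof (intro conjI ballI impI)
    show "?f ` (TQ \<times> TN) \<subseteq> carrier G" using fc by blast
    show "x = y" if "x \<in> ?f ` (TQ \<times> TN)" "y \<in> ?f ` (TQ \<times> TN)" "(x, y) \<in> twisted_conj G \<phi>" for x y
      using that uniq by fastforce
    fix g assume g: "g \<in> carrier G"
    then obtain q where "q \<in> TQ" "(\<pi> g, q) \<in> twisted_conj Q \<kappa>"
      using TQ unfolding transversal_def by (meson \<pi>.hom_closed)
    then obtain d where q: "q \<in> TQ" "q \<in> carrier Q" "d \<in> carrier Q"
      and eq: "\<pi> g \<otimes>\<^bsub>Q\<^esub> \<kappa> d = d \<otimes>\<^bsub>Q\<^esub> q"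
      by (auto simp: iffQ)
    obtain c where c: "c \<in> carrier G" "d = \<pi> c" using q \<pi> by auto
    \<comment> \<open>\<open>?h\<close> measures by how much \<open>g \<otimes> \<phi> c\<close>
      differs from \<open>c \<otimes> s q\<close>. The two agree in \<open>Q\<close>, so
      \<open>?h\<close> comes from \<open>N\<close>.\<close>
    let ?h = "inv\<^bsub>G\<^esub> (c \<otimes>\<^bsub>G\<^esub> s q) \<otimes>\<^bsub>G\<^esub> (g \<otimes>\<^bsub>G\<^esub> \<phi> c)"
    have "\<pi> ?h = \<one>\<^bsub>Q\<^esub>"
      using c g q eq s by (simp add: eqv Q.l_inv)
    then obtain m where m: "m \<in> carrier N" "?h = \<iota> m" using ker[of ?h] c g q s by auto
    have eq1: "g \<otimes>\<^bsub>G\<^esub> \<phi> c = c \<otimes>\<^bsub>G\<^esub> s q \<otimes>\<^bsub>G\<^esub> \<iota> m"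
      unfolding m(2)[symmetric] using c g q s by (simp add: G.m_assoc[symmetric])
    obtain n where "n \<in> TN" "(m, n) \<in> twisted_conj N \<nu>"
      using TN m unfolding transversal_def by meson
    then obtain e where n: "n \<in> TN" "n \<in> carrier N" "e \<in> carrier N"
      and eq2: "m \<otimes>\<^bsub>N\<^esub> \<nu> e = e \<otimes>\<^bsub>N\<^esub> n"
      by (auto simp: iffN)
    \<comment> \<open>Enlarging the conjugator \<open>c\<close> by the central element
      \<open>\<iota> e\<close> keeps the image in \<open>Q\<close> and moves the factor
      \<open>m\<close> to its representative \<open>n\<close>.\<close>
    have "g \<otimes>\<^bsub>G\<^esub> \<phi> (c \<otimes>\<^bsub>G\<^esub> \<iota> e) = (g \<otimes>\<^bsub>G\<^esub> \<phi> c) \<otimes>\<^bsub>G\<^esub> \<iota> (\<nu> e)"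
      using g c n by (simp add: eqv G.m_assoc)
    also have "\<dots> = c \<otimes>\<^bsub>G\<^esub> s q \<otimes>\<^bsub>G\<^esub> \<iota> (m \<otimes>\<^bsub>N\<^esub> \<nu> e)"
      unfolding eq1 using c q s m n by (simp add: G.m_assoc)
    also have "\<dots> = c \<otimes>\<^bsub>G\<^esub> (s q \<otimes>\<^bsub>G\<^esub> \<iota> e) \<otimes>\<^bsub>G\<^esub> \<iota> n"
      unfolding eq2 using c q s m n by (simp add: G.m_assoc)
    also have "s q \<otimes>\<^bsub>G\<^esub> \<iota> e = \<iota> e \<otimes>\<^bsub>G\<^esub> s q" using q s n by (simp add: central)
    finally have "g \<otimes>\<^bsub>G\<^esub> \<phi> (c \<otimes>\<^bsub>G\<^esub> \<iota> e) = c \<otimes>\<^bsub>G\<^esub> \<iota> e \<otimes>\<^bsub>G\<^esub> (s q \<otimes>\<^bsub>G\<^esub> \<iota> n)"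
      using c q s n by (simp add: G.m_assoc)
    then have "(g, ?f (q, n)) \<in> twisted_conj G \<phi>"
      using g c n q s by (auto simp: iffG intro!: bexI[of _ "c \<otimes>\<^bsub>G\<^esub> \<iota> e"])
    then show "\<exists>t\<in>?f ` (TQ \<times> TN). (g, t) \<in> twisted_conj G \<phi>"
      using q n by blast
  qed
  moreover have "inj_on ?f (TQ \<times> TN)"
  proof (rule inj_onI)
    fix x y assume xy: "x \<in> TQ \<times> TN" "y \<in> TQ \<times> TN" "?f x = ?f y"
    \<comment> \<open>Equal products are in particular twisted conjugate, so \<open>uniq\<close>
      also yields injectivity.\<close>
    have "(?f x, ?f x) \<in> twisted_conj G \<phi>"
      using equiv_twisted_conj[OF assms(2) \<phi>] fc[OF xy(1)] by (simp add: equiv_def refl_on_def)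
    then show "x = y" using xy uniq by fastforce
  qed
  ultimately have "reidemeister G \<phi> = ecard (TQ \<times> TN)"
    using reidemeister_transversal[OF assms(2) \<phi>] ecard_image by metis
  also have "\<dots> = ecard TQ * ecard TN"
    using ecard_Times transversal_nonempty TN TQ assms(1) Q.is_group by metis
  finally show ?thesis
    using reidemeister_transversal[OF assms(1) \<nu> TN] reidemeister_transversal[OF Q.is_group \<kappa> TQ]
    by (simp add: mult.commute)
qed

section \<open>Reidemeister spectra of products and of isomorphic groups\<close>

lemma reidemeister_DirProd:
  assumes "group G" "group H" "\<phi> \<in> hom G G" "\<psi> \<in> hom H H"
  shows "reidemeister (G \<times>\<times> H) (\<lambda>(x, y). (\<phi> x, \<psi> y)) = reidemeister G \<phi> * reidemeister H \<psi>"
proof -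
  obtain S where S: "transversal G \<phi> S" using ex_transversal assms by blast
  obtain T where T: "transversal H \<psi> T" using ex_transversal assms by blast
  let ?\<chi> = "\<lambda>(x, y). (\<phi> x, \<psi> y)"
  have \<chi>: "?\<chi> \<in> hom (G \<times>\<times> H) (G \<times>\<times> H)"
    using assms by (auto simp: hom_def DirProd_def)
  have GH: "group (G \<times>\<times> H)" using assms DirProd_group by blast
  have "((a, b), (c, d)) \<in> twisted_conj (G \<times>\<times> H) ?\<chi> \<longleftrightarrow>
      (a, c) \<in> twisted_conj G \<phi> \<and> (b, d) \<in> twisted_conj H \<psi>" for a b c d
    using assms by (auto simp: twisted_conj_iff[OF GH \<chi>] twisted_conj_iff)
  then have "transversal (G \<times>\<times> H) ?\<chi> (S \<times> T)"
    using S T by (fastforce simp: transversal_def)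
  then have "reidemeister (G \<times>\<times> H) ?\<chi> = ecard (S \<times> T)"
    using reidemeister_transversal[OF GH \<chi>] by blast
  also have "\<dots> = ecard S * ecard T"
    using ecard_Times transversal_nonempty S T assms(1,2) by metis
  finally show ?thesis
    using reidemeister_transversal[OF assms(1,3) S] reidemeister_transversal[OF assms(2,4) T] by simp
qed

text \<open>In \<open>enat\<close> one has \<open>0 * \<infinity> = 0\<close>, against the
  convention of \<open>set_times_inf\<close>. Reidemeister numbers are never 0, so on spectra the
  two products agree.\<close>

lemma set_times_inf_spec_R:
  assumes "group G" "group H"
  shows "set_times_inf (spec_R G) (spec_R H) =
    {reidemeister G \<phi> * reidemeister H \<psi> | \<phi> \<psi>. \<phi> \<in> iso G G \<and> \<psi> \<in> iso H H}"
proof -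
  have key: "(if m = \<infinity> \<or> m' = \<infinity> then \<infinity> else m * m') = m * m'"
    if "m \<in> spec_R G" "m' \<in> spec_R H" for m m' :: enat
  proof -
    have "m \<noteq> 0" "m' \<noteq> 0"
      using that assms reidemeister_nonzero by (force simp: spec_R_def iso_iff)+
    then show ?thesis by (auto simp: imult_infinity imult_infinity_right)
  qed
  then have "set_times_inf (spec_R G) (spec_R H) = {m * m' | m m'. m \<in> spec_R G \<and> m' \<in> spec_R H}"
    unfolding set_times_inf_def by (intro Collect_cong ex_cong1) (metis key)
  then show ?thesis by (auto simp: spec_R_def)
qed

lemma set_times_inf_spec_R_subset:
  assumes "group G" "group H"
  shows "set_times_inf (spec_R G) (spec_R H) \<subseteq> spec_R (G \<times>\<times> H)"
proof
  fix x assume "x \<in> set_times_inf (spec_R G) (spec_R H)"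
  then obtain \<phi> \<psi> where *: "\<phi> \<in> iso G G" "\<psi> \<in> iso H H" "x = reidemeister G \<phi> * reidemeister H \<psi>"
    unfolding set_times_inf_spec_R[OF assms] by auto
  then have "(\<lambda>(x, y). (\<phi> x, \<psi> y)) \<in> iso (G \<times>\<times> H) (G \<times>\<times> H)"
    by (simp add: iso_paired2 assms)
  moreover have "x = reidemeister (G \<times>\<times> H) (\<lambda>(x, y). (\<phi> x, \<psi> y))"
    using * reidemeister_DirProd[OF assms] by (simp add: iso_iff)
  ultimately show "x \<in> spec_R (G \<times>\<times> H)" unfolding spec_R_def by blast
qed

text \<open>Conjugating an automorphism of \<open>G\<close> by \<open>f\<close> gives an
  automorphism of \<open>H\<close>, and \<open>f\<close> carries the classes of one to those of the
  other.\<close>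

lemma spec_R_subset_of_iso:
  assumes "group G" "group H" and f: "f \<in> iso G H"
  shows "spec_R G \<subseteq> spec_R H"
proof
  fix x assume "x \<in> spec_R G"
  then obtain \<phi> where \<phi>: "\<phi> \<in> iso G G" and x: "x = reidemeister G \<phi>" by (auto simp: spec_R_def)
  interpret G: group G by fact
  interpret H: group H by fact
  let ?g = "inv_into (carrier G) f"
  let ?\<psi> = "f \<circ> (\<phi> \<circ> ?g)"
  have g: "?g \<in> iso H G" using G.iso_set_sym f by blast
  have \<psi>: "?\<psi> \<in> iso H H" by (meson f g \<phi> iso_set_trans)
  have gf: "?g (f a) = a" if "a \<in> carrier G" for a
    using that f by (simp add: iso_def bij_betw_def)
  have fc: "f a \<in> carrier H" if "a \<in> carrier G" for a
    using that f by (auto simp: iso_def hom_def)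
  have \<phi>c: "\<phi> a \<in> carrier G" if "a \<in> carrier G" for a
    using that \<phi> by (auto simp: iso_def hom_def)
  have fm: "f (a \<otimes>\<^bsub>G\<^esub> b) = f a \<otimes>\<^bsub>H\<^esub> f b" if "a \<in> carrier G" "b \<in> carrier G" for a b
    using that f by (auto simp: iso_def hom_def)
  have img: "f ` carrier G = carrier H" and inj: "inj_on f (carrier G)"
    using f by (auto simp: iso_iff)
  obtain T where T: "transversal G \<phi> T" using ex_transversal assms \<phi> by (metis iso_iff)
  have \<phi>h: "\<phi> \<in> hom G G" and \<psi>h: "?\<psi> \<in> hom H H" using \<phi> \<psi> iso_iff by blast+
  have tc: "(f a, f b) \<in> twisted_conj H ?\<psi> \<longleftrightarrow> (a, b) \<in> twisted_conj G \<phi>"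
    if ab: "a \<in> carrier G" "b \<in> carrier G" for a b
  proof -
    have "(f a \<otimes>\<^bsub>H\<^esub> ?\<psi> (f c) = f c \<otimes>\<^bsub>H\<^esub> f b) \<longleftrightarrow> a \<otimes>\<^bsub>G\<^esub> \<phi> c = c \<otimes>\<^bsub>G\<^esub> b"
      if "c \<in> carrier G" for c
      using that ab by (simp add: gf \<phi>c flip: fm) (simp add: inj_on_eq_iff[OF inj] \<phi>c)
    then show ?thesis
      unfolding twisted_conj_iff[OF assms(1) \<phi>h] twisted_conj_iff[OF assms(2) \<psi>h] img[symmetric]
      using ab by auto
  qed
  have Tc: "T \<subseteq> carrier G" using T by (simp add: transversal_def)
  have "transversal H ?\<psi> (f ` T)"
    unfolding transversal_def img[symmetric]
    using T Tc by (fastforce simp: transversal_def tc subset_iff)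
  then have "reidemeister H ?\<psi> = ecard (f ` T)" using reidemeister_transversal assms \<psi>h by blast
  also have "\<dots> = ecard T" using inj Tc by (meson ecard_image inj_on_subset)
  also have "\<dots> = x" using x reidemeister_transversal assms \<phi>h T by metis
  finally show "x \<in> spec_R H" using \<psi> unfolding spec_R_def by blast
qed

lemma spec_R_cong_iso:
  assumes "group G" "group H" "f \<in> iso G H"
  shows "spec_R G = spec_R H"
  using assms spec_R_subset_of_iso group.iso_set_sym by (metis subset_antisym)

section \<open>Free abelian groups of finite rank\<close>

text \<open>Functions are total with value 0 off \<open>I\<close>, so that the lattice on a subset
  of \<open>I\<close> is literally a subset of the lattice on \<open>I\<close> and inclusions are
  the identity.\<close>

definition lattice_group :: "'a set \<Rightarrow> ('a \<Rightarrow> int) monoid" where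
  "lattice_group I = \<lparr>carrier = {a. \<forall>i. i \<notin> I \<longrightarrow> a i = 0}, monoid.mult = (\<lambda>a b i. a i + b i), one = (\<lambda>_. 0)\<rparr>"

lemma lattice_group_simps [simp]:
  "a \<in> carrier (lattice_group I) \<longleftrightarrow> (\<forall>i. i \<notin> I \<longrightarrow> a i = 0)"
  "a \<otimes>\<^bsub>lattice_group I\<^esub> b = (\<lambda>i. a i + b i)"
  "\<one>\<^bsub>lattice_group I\<^esub> = (\<lambda>_. 0)"
  by (simp_all add: lattice_group_def)

lemma comm_group_lattice_group: "comm_group (lattice_group I)"
proof (rule comm_groupI)
  fix x assume "x \<in> carrier (lattice_group I)"
  then show "\<exists>y\<in>carrier (lattice_group I). y \<otimes>\<^bsub>lattice_group I\<^esub> x = \<one>\<^bsub>lattice_group I\<^esub>"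
    by (intro bexI[of _ "\<lambda>i. - x i"]) auto
qed (auto simp: algebra_simps)

lemma group_lattice_group: "group (lattice_group I)"
  using comm_group_lattice_group by (rule comm_group.axioms)

abbreviation unit_vec :: "'a \<Rightarrow> 'a \<Rightarrow> int" where
  "unit_vec i \<equiv> (\<lambda>j. if j = i then 1 else 0)"

text \<open>Moving a nonzero coordinate one step towards 0 lowers the sum of the absolute values, on
  which the induction runs.\<close>

lemma lattice_group_induct [consumes 2, case_names zero plus minus]:
  assumes "finite I" "a \<in> carrier (lattice_group I)"
    and "Q (\<lambda>_. 0)"
    and plus: "\<And>a i. \<lbrakk>a \<in> carrier (lattice_group I); i \<in> I; Q a\<rbrakk> \<Longrightarrow> Q (\<lambda>j. a j + unit_vec i j)"
    and minus: "\<And>a i. \<lbrakk>a \<in> carrier (lattice_group I); i \<in> I; Q a\<rbrakk> \<Longrightarrow> Q (\<lambda>j. a j - unit_vec i j)"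
  shows "Q a"
  using assms(2)
proof (induction "\<Sum>i\<in>I. nat \<bar>a i\<bar>" arbitrary: a rule: less_induct)
  case less
  show ?case
  proof (cases "\<forall>i\<in>I. a i = 0")
    case True
    then have "a = (\<lambda>_. 0)" using less.prems by auto
    then show ?thesis using assms(3) by simp
  next
    case False
    then obtain i where i: "i \<in> I" "a i \<noteq> 0" by auto
    define s where "s = sgn (a i)"
    define a' where "a' = (\<lambda>j. a j - s * unit_vec i j)"
    have a': "a' \<in> carrier (lattice_group I)" using less.prems i by (auto simp: a'_def)
    have "(\<Sum>i\<in>I. nat \<bar>a' i\<bar>) < (\<Sum>i\<in>I. nat \<bar>a i\<bar>)"
      using i by (intro sum_strict_mono_ex1) (auto simp: assms(1) a'_def s_def sgn_if)
    then have Q: "Q a'" using less.hyps a' by blast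
    consider "s = 1" | "s = -1" unfolding s_def using i by (cases "a i > 0") auto
    then show ?thesis
    proof cases
      case 1
      then show ?thesis using plus[OF a' i(1) Q] by (simp add: a'_def)
    next
      case 2
      then show ?thesis using minus[OF a' i(1) Q] by (simp add: a'_def)
    qed
  qed
qed

lemma spec_R_Zpow:
  assumes "finite I"
  shows "spec_R (Zpow (card I)) = spec_R (lattice_group I)"
proof -
  obtain h where h: "bij_betw h {..<card I} I"
    using ex_bij_betw_nat_finite[OF assms] by (auto simp: atLeast0LessThan)
  \<comment> \<open>\<open>product_group\<close> consists of extensional functions,
    \<open>undefined\<close> off the index set, while \<open>lattice_group\<close> has 0 there. Each
    direction therefore inserts the default value of its target.\<close>
  let ?f = "\<lambda>a. \<lambda>k\<in>{..<card I}. a (h k)"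
  let ?g = "\<lambda>f i. if i \<in> I then f (inv_into {..<card I} h i) else (0::int)"
  have hI: "h k \<in> I" if "k < card I" for k using h that by (auto simp: bij_betw_def)
  have inv1: "inv_into {..<card I} h (h k) = k" if "k < card I" for k
    using h that by (simp add: bij_betw_def)
  have inv2: "h (inv_into {..<card I} h i) = i" "inv_into {..<card I} h i < card I" if "i \<in> I" for i
    using h that bij_betw_inv_into_right[OF h that] inv_into_into[of i h "{..<card I}"]
    by (auto simp: bij_betw_def)
  have "bij_betw ?f (carrier (lattice_group I)) (carrier (Zpow (card I)))"
    by (rule bij_betwI[where g = ?g])
      (auto simp: Zpow_def hI inv1 inv2 PiE_iff extensional_def fun_eq_iff)
  moreover have "?f \<in> hom (lattice_group I) (Zpow (card I))"
    by (auto simp: hom_def Zpow_def fun_eq_iff)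
  ultimately have "?f \<in> iso (lattice_group I) (Zpow (card I))" by (simp add: iso_def)
  moreover have "group (Zpow (card I))" unfolding Zpow_def by (rule product_group) simp
  ultimately show ?thesis using spec_R_cong_iso group_lattice_group by metis
qed

section \<open>Homomorphisms between lattices\<close>

context
  fixes I :: "'a set" and J :: "'b set" and f
  assumes f: "f \<in> hom (lattice_group I) (lattice_group J)"
begin

lemma lattice_hom_closed: "a \<in> carrier (lattice_group I) \<Longrightarrow> f a \<in> carrier (lattice_group J)"
  using f unfolding hom_def by blast

lemma lattice_hom_add:
  "\<lbrakk>a \<in> carrier (lattice_group I); b \<in> carrier (lattice_group I)\<rbrakk> \<Longrightarrow> f (\<lambda>i. a i + b i) = (\<lambda>i. f a i + f b i)"
  using f by (simp add: hom_def)

lemma lattice_hom_zero: "f (\<lambda>_. 0) = (\<lambda>_. 0)"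
  using lattice_hom_add[of "\<lambda>_. 0" "\<lambda>_. 0"] by (simp add: fun_eq_iff)

lemma lattice_hom_minus:
  assumes "a \<in> carrier (lattice_group I)"
  shows "f (\<lambda>i. - a i) = (\<lambda>i. - f a i)"
proof -
  have "f (\<lambda>i. a i + - a i) = (\<lambda>i. f a i + f (\<lambda>i. - a i) i)"
    using lattice_hom_add[of a "\<lambda>i. - a i"] assms by simp
  then show ?thesis by (simp add: lattice_hom_zero fun_eq_iff eq_neg_iff_add_eq_0 add.commute)
qed

lemma lattice_hom_scale:
  assumes a: "a \<in> carrier (lattice_group I)"
  shows "f (\<lambda>i. k * a i) = (\<lambda>i. k * f a i)"
proof -
  have nat: "f (\<lambda>i. int n * a i) = (\<lambda>i. int n * f a i)" for n
  proof (induction n)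
    case 0
    show ?case by (simp add: lattice_hom_zero)
  next
    case (Suc n)
    have "f (\<lambda>i. int (Suc n) * a i) = f (\<lambda>i. a i + int n * a i)" by (simp add: algebra_simps)
    also have "\<dots> = (\<lambda>i. f a i + f (\<lambda>i. int n * a i) i)" using a by (subst lattice_hom_add) auto
    finally show ?case by (simp add: Suc algebra_simps)
  qed
  show ?thesis
  proof (cases "k \<ge> 0")
    case True
    then show ?thesis using nat[of "nat k"] by simp
  next
    case False
    then have "f (\<lambda>i. - (k * a i)) = (\<lambda>i. - (k * f a i))" using nat[of "nat (- k)"] by simp
    then show ?thesis using lattice_hom_minus[of "\<lambda>i. - (k * a i)"] a by simp
  qed
qed

end

text \<open>If the classes were finite in number, then \<open>1 - \<delta>\<close> would be surjective modulo every \<open>m\<close> coprime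
  to some fixed \<open>N\<close>, hence injective modulo \<open>m\<close> by finiteness; a fixed vector would vanish modulo
  arbitrarily large \<open>m\<close>.\<close>

lemma reidemeister_lattice_infinite:
  assumes fin: "finite I" and \<delta>: "\<delta> \<in> hom (lattice_group I) (lattice_group I)"
    and v: "v \<in> carrier (lattice_group I)" "\<delta> v = v" "v \<noteq> (\<lambda>_. 0)"
  shows "reidemeister (lattice_group I) \<delta> = \<infinity>"
proof (rule ccontr)
  assume R: "reidemeister (lattice_group I) \<delta> \<noteq> \<infinity>"
  let ?L = "carrier (lattice_group I)"
  let ?r = "twisted_conj (lattice_group I) \<delta>"
  obtain T where T: "transversal (lattice_group I) \<delta> T"
    using ex_transversal \<delta> group_lattice_group by blast
  have finT: "finite T"
    using R reidemeister_transversal[OF group_lattice_group \<delta> T] by (auto simp: ecard_def split: if_splits)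
  \<comment> \<open>\<open>M\<close> is \<open>1 - \<delta>\<close>; the twisted classes are the
    cosets of its image.\<close>
  define M where "M c = (\<lambda>i. c i - \<delta> c i)" for c
  have M: "M \<in> hom (lattice_group I) (lattice_group I)"
    using lattice_hom_add[OF \<delta>] lattice_hom_closed[OF \<delta>]
    by (auto simp: hom_def M_def fun_eq_iff)
  have r_iff: "(a, b) \<in> ?r \<longleftrightarrow> (\<exists>c\<in>?L. (\<lambda>i. a i - b i) = M c)" if "a \<in> ?L" "b \<in> ?L" for a b
    using that unfolding twisted_conj_iff[OF group_lattice_group \<delta>]
    by (auto simp: M_def fun_eq_iff algebra_simps)
  \<comment> \<open>Among the multiples \<open>0 * a, ..., card T * a\<close> two share a class, so
    some \<open>(l - k) * a\<close> with \<open>0 < l - k \<le> card T\<close> is in the image of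
    \<open>M\<close>. The factorial is a multiple of every such difference, hence works for all
    \<open>a\<close> at once.\<close>
  define N where "N = int (fact (card T))"
  have N1: "N \<ge> 1" by (simp add: N_def)
  have NM: "\<exists>c\<in>?L. (\<lambda>i. N * a i) = M c" if a: "a \<in> ?L" for a
  proof -
    define t where "t k = (SOME t. t \<in> T \<and> ((\<lambda>i. int k * a i), t) \<in> ?r)" for k
    have t: "t k \<in> T \<and> ((\<lambda>i. int k * a i), t k) \<in> ?r" for k
    proof -
      have "\<exists>t\<in>T. ((\<lambda>i. int k * a i), t) \<in> ?r" using T a unfolding transversal_def by auto
      then show ?thesis unfolding t_def by (metis (mono_tags, lifting) someI_ex)
    qed
    have "card (t ` {0..card T}) \<le> card T" using t by (intro card_mono finT) auto
    then have "\<not> inj_on t {0..card T}" by (intro pigeonhole) auto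
    then obtain k l where kl: "k < l" "l \<le> card T" "t k = t l"
      by (auto simp: inj_on_def) (metis nat_neq_iff)
    have "((\<lambda>i. int l * a i), (\<lambda>i. int k * a i)) \<in> ?r"
      using t[of k] t[of l] kl(3) equiv_twisted_conj[OF group_lattice_group \<delta>]
      by (metis equiv_def symD transD)
    then obtain c where c: "c \<in> ?L" "(\<lambda>i. int l * a i - int k * a i) = M c"
      using r_iff a by auto
    have "l - k dvd fact (card T)" using kl by (intro dvd_fact) auto
    then obtain q where "fact (card T) = (l - k) * q" by (auto elim: dvdE)
    then have q: "N = int q * (int l - int k)" using kl unfolding N_def
      by (metis mult.commute of_nat_diff of_nat_mult order_less_imp_le)
    have "M (\<lambda>i. int q * c i) = (\<lambda>i. int q * M c i)" using lattice_hom_scale[OF M c(1)] .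
    also have "\<dots> = (\<lambda>i. N * a i)" unfolding c(2)[symmetric] q by (simp add: algebra_simps)
    finally show ?thesis using c(1) by (intro bexI[of _ "\<lambda>i. int q * c i"]) auto
  qed
  obtain i0 where i0: "v i0 \<noteq> 0" using v(3) by auto
  \<comment> \<open>This modulus exceeds \<open>\<bar>v i0\<bar>\<close>, and modulo it
    \<open>N\<close> is invertible with inverse \<open>- \<bar>v i0\<bar>\<close>.\<close>
  define m where "m = N * \<bar>v i0\<bar> + 1"
  have "1 * \<bar>v i0\<bar> \<le> N * \<bar>v i0\<bar>" using N1 by (intro mult_right_mono) auto
  then have m: "m > \<bar>v i0\<bar>" "m > 0" by (auto simp: m_def)
  \<comment> \<open>Coordinatewise reduction modulo \<open>m\<close>, with \<open>B\<close> as the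
    finite set of reduced vectors.\<close>
  define red where "red c = (\<lambda>i. c i mod m)" for c :: "'a \<Rightarrow> int"
  define B where "B = {c \<in> ?L. \<forall>i\<in>I. c i \<in> {0..<m}}"
  have redB: "red c \<in> B" if "c \<in> ?L" for c
    using that m by (auto simp: red_def B_def)
  have redB_id: "red c = c" if "c \<in> B" for c
  proof
    show "red c i = c i" for i using that by (cases "i \<in> I") (auto simp: red_def B_def)
  qed
  have "finite {c. \<forall>i. (i \<in> I \<longrightarrow> c i \<in> {0..<m}) \<and> (i \<notin> I \<longrightarrow> c i = 0)}"
    by (rule finite_set_of_finite_funs) (use fin in auto)
  then have finB: "finite B" by (rule rev_finite_subset) (auto simp: B_def)
  have red_M: "red (M (red c)) = red (M c)" if c: "c \<in> ?L" for c
  proof -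
    let ?q = "\<lambda>i. c i div m"
    have q: "?q \<in> ?L" using c by auto
    have "M c = M (\<lambda>i. red c i + m * ?q i)" by (simp add: red_def)
    also have "\<dots> = (\<lambda>i. M (red c) i + m * M ?q i)"
      using lattice_hom_add[OF M, of "red c" "\<lambda>i. m * ?q i"] lattice_hom_scale[OF M q] c q
      by (auto simp: red_def)
    finally show ?thesis by (simp add: red_def)
  qed
  have Mc: "M c \<in> ?L" if "c \<in> ?L" for c using lattice_hom_closed[OF M that] .
  have surj: "B \<subseteq> (\<lambda>c. red (M c)) ` B"
  proof
    fix b assume b: "b \<in> B"
    then have bL: "b \<in> ?L" by (simp add: B_def)
    \<comment> \<open>Scaling \<open>b\<close> by the inverse of \<open>N\<close> before applying
      \<open>NM\<close> gives a vector in the image of \<open>M\<close> that is congruent to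
      \<open>b\<close> modulo \<open>m\<close>.\<close>
    obtain c where c: "c \<in> ?L" "(\<lambda>i. N * (- \<bar>v i0\<bar> * b i)) = M c"
      using NM[of "\<lambda>i. - \<bar>v i0\<bar> * b i"] bL by auto
    have "red (M c) = red b"
    proof
      fix i
      have "N * (- \<bar>v i0\<bar> * b i) = b i + m * (- b i)" by (simp add: m_def algebra_simps)
      then show "red (M c) i = red b i"
        unfolding red_def c(2)[symmetric] by (metis mod_mult_self2)
    qed
    then have "red (M (red c)) = b" using red_M[OF c(1)] redB_id[OF b] by simp
    then show "b \<in> (\<lambda>c. red (M c)) ` B" using redB[OF c(1)] by force
  qed
  have "(\<lambda>c. red (M c)) ` B \<subseteq> B" using redB Mc by (auto simp: B_def)
  then have inj: "inj_on (\<lambda>c. red (M c)) B"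
    using finB surj by (metis eq_card_imp_inj_on subset_antisym)
  \<comment> \<open>As \<open>v\<close> is fixed, \<open>M v\<close> vanishes, so
    \<open>red v\<close> and 0 have the same image under an injective map. Then \<open>m\<close>
    divides \<open>v i0\<close>, which is nonzero and smaller in absolute value than
    \<open>m\<close>.\<close>
  have "red (M (red v)) = red (M (\<lambda>_. 0))"
    using red_M[OF v(1)] lattice_hom_zero[OF M] by (simp add: M_def v(2))
  moreover have "red v \<in> B" "(\<lambda>_. 0) \<in> B" using redB[OF v(1)] m by (auto simp: B_def)
  ultimately have "red v = (\<lambda>_. 0)" using inj by (meson inj_onD)
  then have "m dvd v i0" by (auto simp: red_def fun_eq_iff)
  then show False using m i0 by (meson dvd_abs_iff zdvd_not_zless zero_less_abs_iff)
qed

section \<open>A model of two-step nilpotent groups\<close>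

text \<open>For \<open>(i, j) \<in> P\<close>, moving \<open>x\<^sub>j\<close> rightwards past \<open>x\<^sub>i\<close> creates \<open>y\<^sub>i\<^sub>j\<close>; the pair \<open>(a, b)\<close> is the
  normal form in which the \<open>x\<^sub>i\<close> with exponents \<open>a i\<close> occur in increasing order, followed by the \<open>y\<^sub>i\<^sub>j\<close> with
  exponents \<open>b (i, j)\<close>.\<close>

definition nil2 :: "'a set \<Rightarrow> ('a \<times> 'a) set \<Rightarrow> (('a \<Rightarrow> int) \<times> ('a \<times> 'a \<Rightarrow> int)) monoid" where
  "nil2 V P = \<lparr>carrier = carrier (lattice_group V) \<times> carrier (lattice_group P),
     monoid.mult = (\<lambda>(a, b) (a', b').
       (\<lambda>i. a i + a' i, \<lambda>p. b p + b' p + of_bool (p \<in> P) * (a (snd p) * a' (fst p)))),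
     one = (\<lambda>_. 0, \<lambda>_. 0)\<rparr>"

lemma nil2_simps [simp]:
  "(a, b) \<in> carrier (nil2 V P) \<longleftrightarrow> a \<in> carrier (lattice_group V) \<and> b \<in> carrier (lattice_group P)"
  "(a, b) \<otimes>\<^bsub>nil2 V P\<^esub> (a', b') =
     (\<lambda>i. a i + a' i, \<lambda>p. b p + b' p + of_bool (p \<in> P) * (a (snd p) * a' (fst p)))"
  "\<one>\<^bsub>nil2 V P\<^esub> = (\<lambda>_. 0, \<lambda>_. 0)"
  by (simp_all add: nil2_def)

lemma nil2_carrierD:
  assumes "g \<in> carrier (nil2 V P)"
  shows "fst g \<in> carrier (lattice_group V)" "snd g \<in> carrier (lattice_group P)"
  using assms by (cases g; simp)+

lemma fst_nil2_mult: "fst (g \<otimes>\<^bsub>nil2 V P\<^esub> h) = (\<lambda>i. fst g i + fst h i)"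
  by (cases g; cases h) simp

lemma group_nil2: "group (nil2 V P)"
proof (rule groupI)
  fix x assume "x \<in> carrier (nil2 V P)"
  then obtain a b where x: "x = (a, b)" "(a, b) \<in> carrier (nil2 V P)" by (cases x) auto
  show "\<exists>y\<in>carrier (nil2 V P). y \<otimes>\<^bsub>nil2 V P\<^esub> x = \<one>\<^bsub>nil2 V P\<^esub>"
    using x by (intro bexI[of _ "(\<lambda>i. - a i, \<lambda>p. - b p + of_bool (p \<in> P) * (a (snd p) * a (fst p)))"])
      (auto simp: fun_eq_iff)
qed (auto simp: fun_eq_iff algebra_simps)

lemma fst_in_hom: "fst \<in> hom (nil2 V P) (lattice_group V)"
  using nil2_carrierD by (intro homI) (auto simp: fst_nil2_mult)

lemma nil2_Pair_zero_hom: "Pair (\<lambda>_. 0) \<in> hom (lattice_group P) (nil2 V P)"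
  by (intro homI) auto

text \<open>\<open>P\<close> picks one orientation for each noncommuting pair of generators. The
  case \<open>i = j\<close> of \<open>antisym\<close> also excludes loops.\<close>

locale oriented =
  fixes V :: "'a set" and P :: "('a \<times> 'a) set"
  assumes finV: "finite V" and PV: "P \<subseteq> V \<times> V"
    and antisym: "(i, j) \<in> P \<Longrightarrow> (j, i) \<notin> P"
begin

lemma finP: "finite P"
  using PV finV finite_subset by blast

text \<open>A homomorphism to an abelian group vanishes on \<open>[x\<^sub>j, x\<^sub>i] = y\<^sub>i\<^sub>j\<close>.\<close>

lemma abelian_hom_vanishes:
  assumes f: "f \<in> hom (nil2 V P) (lattice_group J)" and b: "b \<in> carrier (lattice_group P)"
  shows "f (\<lambda>_. 0, b) = (\<lambda>_. 0)"
proof -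
  have mult: "f (g \<otimes>\<^bsub>nil2 V P\<^esub> h) = (\<lambda>i. f g i + f h i)"
    if "g \<in> carrier (nil2 V P)" "h \<in> carrier (nil2 V P)" for g h
    using f that by (simp add: hom_def)
  have Pair_zero: "f (\<lambda>_. 0, \<lambda>p. b p + b' p) = (\<lambda>i. f (\<lambda>_. 0, b) i + f (\<lambda>_. 0, b') i)"
    if "b \<in> carrier (lattice_group P)" "b' \<in> carrier (lattice_group P)" for b b'
    using mult[of "(\<lambda>_. 0, b)" "(\<lambda>_. 0, b')"] that by simp
  have unit: "f (\<lambda>_. 0, unit_vec p) = (\<lambda>_. 0)" if "p \<in> P" for p
  proof -
    obtain i j where p: "p = (i, j)" by (cases p)
    have ij: "i \<in> V" "j \<in> V" "(j, i) \<notin> P" using that p PV antisym by auto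
    let ?x = "\<lambda>i. (unit_vec i, \<lambda>_. 0) :: ('a \<Rightarrow> int) \<times> ('a \<times> 'a \<Rightarrow> int)"
    have c: "?x i \<in> carrier (nil2 V P)" "?x j \<in> carrier (nil2 V P)"
      "(\<lambda>_. 0, unit_vec p) \<in> carrier (nil2 V P)" using ij that by auto
    \<comment> \<open>The left product acquires coordinate 1 at \<open>p\<close>;
      \<open>?x i \<otimes> ?x j\<close> could only acquire one at \<open>(j, i)\<close>, which is
      not in \<open>P\<close>. In the abelian target both products of the \<open>?x\<close> have the
      same image, so that of the last factor is 0.\<close>
    have "?x j \<otimes>\<^bsub>nil2 V P\<^esub> ?x i = (?x i \<otimes>\<^bsub>nil2 V P\<^esub> ?x j) \<otimes>\<^bsub>nil2 V P\<^esub> (\<lambda>_. 0, unit_vec p)"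
      using ij that p by (auto simp: fun_eq_iff)
    then have "f (?x j \<otimes>\<^bsub>nil2 V P\<^esub> ?x i) =
        f ((?x i \<otimes>\<^bsub>nil2 V P\<^esub> ?x j) \<otimes>\<^bsub>nil2 V P\<^esub> (\<lambda>_. 0, unit_vec p))" by simp
    then show ?thesis
      using c by (simp only: mult group.is_monoid[OF group_nil2] monoid.m_closed) (simp add: fun_eq_iff)
  qed
  show ?thesis
    using finP b
  proof (induction rule: lattice_group_induct)
    case zero
    show ?case using Pair_zero[of "\<lambda>_. 0" "\<lambda>_. 0"] by (simp add: fun_eq_iff)
  next
    case (plus a i)
    then show ?case using Pair_zero[of a "unit_vec i"] unit[of i] by simp
  next
    case (minus a i)
    then show ?case
      using Pair_zero[of "\<lambda>j. a j - unit_vec i j" "unit_vec i"] unit[of i] by simp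
  qed
qed

section \<open>Endomorphisms of the model and the maps they induce\<close>

context
  fixes \<phi> assumes \<phi>: "\<phi> \<in> hom (nil2 V P) (nil2 V P)"
begin

text \<open>The induced map on the quotient lattice on \<open>V\<close> is computed at the
  representative \<open>(a, \<lambda>_. 0)\<close>; by \<open>fst_image\<close> any other gives the
  same result. By \<open>fst_comm\<close>, \<open>comm_part\<close> retains all of
  \<open>\<phi>\<close> on the \<open>y\<close> lattice.\<close>

abbreviation "ab_part \<equiv> \<lambda>a. fst (\<phi> (a, \<lambda>_. 0))"
abbreviation "comm_part \<equiv> \<lambda>b. snd (\<phi> (\<lambda>_. 0, b))"

lemma \<phi>_closed: "g \<in> carrier (nil2 V P) \<Longrightarrow> \<phi> g \<in> carrier (nil2 V P)"
  using \<phi> unfolding hom_def by blast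

lemma \<phi>_mult: "\<lbrakk>g \<in> carrier (nil2 V P); h \<in> carrier (nil2 V P)\<rbrakk> \<Longrightarrow>
    \<phi> (g \<otimes>\<^bsub>nil2 V P\<^esub> h) = \<phi> g \<otimes>\<^bsub>nil2 V P\<^esub> \<phi> h"
  using \<phi> unfolding hom_def by blast

text \<open>Following \<open>\<phi>\<close> by \<open>fst\<close> gives a homomorphism to an abelian
  group, which kills commutators.\<close>

lemma fst_comm:
  assumes "b \<in> carrier (lattice_group P)"
  shows "fst (\<phi> (\<lambda>_. 0, b)) = (\<lambda>_. 0)"
  using abelian_hom_vanishes[OF hom_compose[OF \<phi> fst_in_hom] assms] by simp

lemma image_comm:
  assumes "b \<in> carrier (lattice_group P)"
  shows "\<phi> (\<lambda>_. 0, b) = (\<lambda>_. 0, comm_part b)"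
  using fst_comm[OF assms] by (simp add: prod_eq_iff)

lemma fst_image:
  assumes "g \<in> carrier (nil2 V P)"
  shows "fst (\<phi> g) = ab_part (fst g)"
proof -
  obtain a b where g: "g = (a, b)" by (cases g)
  have "\<phi> g = \<phi> (a, \<lambda>_. 0) \<otimes>\<^bsub>nil2 V P\<^esub> \<phi> (\<lambda>_. 0, b)"
    unfolding g using assms \<phi>_mult[of "(a, \<lambda>_. 0)" "(\<lambda>_. 0, b)"] by (simp add: g)
  then show ?thesis using assms fst_comm[of b] by (simp add: g fst_nil2_mult)
qed

lemma ab_part_hom: "ab_part \<in> hom (lattice_group V) (lattice_group V)"
proof (rule homI)
  show "ab_part a \<in> carrier (lattice_group V)" if "a \<in> carrier (lattice_group V)" for a
    using that nil2_carrierD(1)[OF \<phi>_closed[of "(a, \<lambda>_. 0)"]] by simp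
  fix a b assume ab: "a \<in> carrier (lattice_group V)" "b \<in> carrier (lattice_group V)"
  let ?g = "(a, \<lambda>_. 0) \<otimes>\<^bsub>nil2 V P\<^esub> (b, \<lambda>_. 0)"
  have c: "(a, \<lambda>_. 0) \<in> carrier (nil2 V P)" "(b, \<lambda>_. 0) \<in> carrier (nil2 V P)" using ab by auto
  have "ab_part (fst ?g) = fst (\<phi> ?g)"
    by (rule fst_image[symmetric]) (intro monoid.m_closed group.is_monoid group_nil2 c)
  then show "ab_part (a \<otimes>\<^bsub>lattice_group V\<^esub> b) = ab_part a \<otimes>\<^bsub>lattice_group V\<^esub> ab_part b"
    unfolding \<phi>_mult[OF c] fst_nil2_mult by simp
qed

lemma comm_part_hom: "comm_part \<in> hom (lattice_group P) (lattice_group P)"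
proof (rule homI)
  show "comm_part b \<in> carrier (lattice_group P)" if "b \<in> carrier (lattice_group P)" for b
    using that nil2_carrierD(2)[OF \<phi>_closed[of "(\<lambda>_. 0, b)"]] by simp
  fix a b assume ab: "a \<in> carrier (lattice_group P)" "b \<in> carrier (lattice_group P)"
  have "\<phi> (\<lambda>_. 0, \<lambda>p. a p + b p) = (\<lambda>_. 0, comm_part a) \<otimes>\<^bsub>nil2 V P\<^esub> (\<lambda>_. 0, comm_part b)"
    using ab \<phi>_mult[of "(\<lambda>_. 0, a)" "(\<lambda>_. 0, b)"] image_comm[OF ab(1)] image_comm[OF ab(2)] by simp
  then show "comm_part (a \<otimes>\<^bsub>lattice_group P\<^esub> b) = comm_part a \<otimes>\<^bsub>lattice_group P\<^esub> comm_part b"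
    by simp
qed

lemma fst_nil2_surj: "fst ` carrier (nil2 V P) = carrier (lattice_group V)"
  by (force simp: nil2_def)

lemma reidemeister_nil2:
  assumes "\<And>a. \<lbrakk>a \<in> carrier (lattice_group V); ab_part a = a\<rbrakk> \<Longrightarrow> a = (\<lambda>_. 0)"
  shows "reidemeister (nil2 V P) \<phi> =
    reidemeister (lattice_group P) comm_part * reidemeister (lattice_group V) ab_part"
proof (rule reidemeister_central_extension[where \<iota> = "Pair (\<lambda>_. 0)" and \<pi> = fst and \<phi> = \<phi>
        and \<nu> = comm_part and \<kappa> = ab_part,
      OF group_lattice_group group_nil2 comm_group_lattice_group nil2_Pair_zero_hom _ fst_in_hom fst_nil2_surj _ _ comm_part_hom \<phi> ab_part_hom])
  show "Pair (\<lambda>_. 0) ` carrier (lattice_group P) = kernel (nil2 V P) (lattice_group V) fst"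
    by (force simp: kernel_def nil2_def)
  show "(\<lambda>_. 0, n) \<otimes>\<^bsub>nil2 V P\<^esub> g = g \<otimes>\<^bsub>nil2 V P\<^esub> (\<lambda>_. 0, n)" for n g
    by (cases g) (simp add: fun_eq_iff)
  show "inj_on (Pair (\<lambda>_. 0)) (carrier (lattice_group P))" by (simp add: inj_on_def)
  show "q = \<one>\<^bsub>lattice_group V\<^esub>" if "q \<in> carrier (lattice_group V)" "ab_part q = q" for q
    using assms[OF that] by simp
qed (rule image_comm fst_image; assumption)+

lemma reidemeister_nil2_infinite:
  assumes "reidemeister (lattice_group V) ab_part = \<infinity>"
  shows "reidemeister (nil2 V P) \<phi> = \<infinity>"
  by (rule reidemeister_quotient_infinite[where \<pi> = fst and \<kappa> = ab_part, OF group_nil2 group_lattice_group \<phi> ab_part_hom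
        fst_in_hom fst_nil2_surj fst_image assms])

end

end

section \<open>Splitting off the generators that commute with all others\<close>

definition restrict0 :: "'a set \<Rightarrow> ('a \<Rightarrow> int) \<Rightarrow> 'a \<Rightarrow> int" where
  "restrict0 W a = (\<lambda>i. if i \<in> W then a i else 0)"

lemma restrict0_closed [simp]: "restrict0 W a \<in> carrier (lattice_group W)"
  by (simp add: restrict0_def)

lemma restrict0_add: "restrict0 W (\<lambda>i. a i + b i) = (\<lambda>i. restrict0 W a i + restrict0 W b i)"
  by (auto simp: restrict0_def)

lemma restrict0_id: "a \<in> carrier (lattice_group W) \<Longrightarrow> restrict0 W a = a"
  by (auto simp: restrict0_def)

lemma restrict0_hom: "restrict0 W \<in> hom (lattice_group V) (lattice_group W)"
  by (rule homI) (auto simp: restrict0_def)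

text \<open>\<open>PW\<close> makes the generators in \<open>U\<close> central, and
  \<open>noncentral\<close> denies this to each generator in \<open>W\<close>. Together they
  determine the centre of \<open>nil2 (U \<union> W) P\<close>, see
  \<open>commute_iff\<close>.\<close>

locale central_split =
  fixes U W :: "'a set" and P :: "('a \<times> 'a) set"
  assumes finU: "finite U" and finW: "finite W" and disj: "U \<inter> W = {}"
    and PW: "P \<subseteq> W \<times> W" and antisym: "(i, j) \<in> P \<Longrightarrow> (j, i) \<notin> P"
    and noncentral: "w \<in> W \<Longrightarrow> \<exists>u. (w, u) \<in> P \<or> (u, w) \<in> P"
begin

abbreviation "G \<equiv> nil2 (U \<union> W) P"
abbreviation "H \<equiv> nil2 W P"

sublocale G: oriented "U \<union> W" P
  using finU finW PW antisym by unfold_locales auto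

sublocale H: oriented W P
  using finW PW antisym by unfold_locales auto

lemma restrict0_zero_iff:
  assumes "a \<in> carrier (lattice_group (U \<union> W))"
  shows "restrict0 W a = (\<lambda>_. 0) \<longleftrightarrow> a \<in> carrier (lattice_group U)"
proof -
  have "restrict0 W a = (\<lambda>_. 0) \<longleftrightarrow> (\<forall>i\<in>W. a i = 0)"
    by (auto simp: restrict0_def fun_eq_iff)
  also have "\<dots> \<longleftrightarrow> (\<forall>i. i \<notin> U \<longrightarrow> a i = 0)"
    using assms disj unfolding lattice_group_simps by blast
  finally show ?thesis by simp
qed

lemma lattice_inclusion:
  "a \<in> carrier (lattice_group U) \<Longrightarrow> a \<in> carrier (lattice_group (U \<union> W))"
  "a \<in> carrier (lattice_group W) \<Longrightarrow> a \<in> carrier (lattice_group (U \<union> W))"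
  by auto

lemma lattice_disjoint:
  "\<lbrakk>a \<in> carrier (lattice_group U); a \<in> carrier (lattice_group W)\<rbrakk> \<Longrightarrow> a = (\<lambda>_. 0)"
  using disj unfolding lattice_group_simps by blast

lemma H_subset: "h \<in> carrier H \<Longrightarrow> h \<in> carrier G"
  by (cases h) auto

lemma H_mult: "g \<otimes>\<^bsub>H\<^esub> h = g \<otimes>\<^bsub>G\<^esub> h"
  by (cases g; cases h) simp

text \<open>Commuting \<open>g = (a, b)\<close> with the unit vector at a partner \<open>u\<close>
  of \<open>w\<close> in \<open>P\<close> isolates the coordinate \<open>a w\<close> and makes it 0.
  Conversely, the twisting term of the product reads only coordinates in \<open>W\<close>.\<close>

lemma commute_iff:
  assumes "g \<in> carrier G"
  shows "(\<forall>h\<in>carrier G. g \<otimes>\<^bsub>G\<^esub> h = h \<otimes>\<^bsub>G\<^esub> g) \<longleftrightarrow> fst g \<in> carrier (lattice_group U)"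
proof -
  obtain a b where g: "g = (a, b)" by (cases g)
  have a: "a i = 0" if "i \<notin> U \<union> W" for i using assms that by (simp add: g)
  show ?thesis
  proof
    assume *: "\<forall>h\<in>carrier G. g \<otimes>\<^bsub>G\<^esub> h = h \<otimes>\<^bsub>G\<^esub> g"
    have comm: "a (snd p) * c (fst p) = c (snd p) * a (fst p)"
      if "c \<in> carrier (lattice_group (U \<union> W))" "p \<in> P" for c p
    proof -
      have "(c, \<lambda>_. 0) \<in> carrier G" using that by simp
      with * have "g \<otimes>\<^bsub>G\<^esub> (c, \<lambda>_. 0) = (c, \<lambda>_. 0) \<otimes>\<^bsub>G\<^esub> g" by blast
      then have "snd (g \<otimes>\<^bsub>G\<^esub> (c, \<lambda>_. 0)) p = snd ((c, \<lambda>_. 0) \<otimes>\<^bsub>G\<^esub> g) p" by simp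
      then show ?thesis using that by (simp add: g)
    qed
    have "a w = 0" if w: "w \<in> W" for w
    proof -
      obtain u where u: "(w, u) \<in> P \<or> (u, w) \<in> P" using noncentral[OF w] by blast
      then have "u \<in> W" "u \<noteq> w" using PW antisym by auto
      then show ?thesis
        using u comm[of "unit_vec u" "(w, u)"] comm[of "unit_vec u" "(u, w)"] by auto
    qed
    then show "fst g \<in> carrier (lattice_group U)" using a by (auto simp: g)
  next
    assume "fst g \<in> carrier (lattice_group U)"
    then have "a i = 0" if "i \<in> W" for i using that disj by (auto simp: g)
    then have "a (fst p) = 0" "a (snd p) = 0" if "p \<in> P" for p using PW that by auto
    then show "\<forall>h\<in>carrier G. g \<otimes>\<^bsub>G\<^esub> h = h \<otimes>\<^bsub>G\<^esub> g" by (auto simp: g fun_eq_iff)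
  qed
qed

text \<open>An automorphism maps the centre into itself, and \<open>commute_iff\<close> describes
  the centre by the support of \<open>fst\<close>.\<close>

lemma image_center:
  assumes "\<phi> \<in> iso G G" "g \<in> carrier G" "fst g \<in> carrier (lattice_group U)"
  shows "fst (\<phi> g) \<in> carrier (lattice_group U)"
proof -
  have \<phi>: "\<phi> \<in> hom G G" "\<phi> ` carrier G = carrier G" using assms(1) by (simp_all add: iso_iff)
  have "\<phi> g \<otimes>\<^bsub>G\<^esub> h = h \<otimes>\<^bsub>G\<^esub> \<phi> g" if "h \<in> carrier G" for h
  proof -
    obtain k where k: "k \<in> carrier G" "h = \<phi> k" using \<phi>(2) \<open>h \<in> carrier G\<close> by (metis imageE)
    have "g \<otimes>\<^bsub>G\<^esub> k = k \<otimes>\<^bsub>G\<^esub> g" using commute_iff[OF assms(2)] assms(3) k by blast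
    then show ?thesis using k assms(2) G.\<phi>_mult[OF \<phi>(1)] by metis
  qed
  then show ?thesis using commute_iff[OF G.\<phi>_closed[OF \<phi>(1) assms(2)]] by blast
qed

definition proj :: "('a \<Rightarrow> int) \<times> ('a \<times> 'a \<Rightarrow> int) \<Rightarrow> ('a \<Rightarrow> int) \<times> ('a \<times> 'a \<Rightarrow> int)" where
  "proj g = (restrict0 W (fst g), snd g)"

text \<open>Erasing the coordinates in \<open>U\<close> respects products because \<open>P\<close>
  lies in \<open>W \<times> W\<close>, so the twisting term never sees them.\<close>

lemma proj_hom: "proj \<in> hom G H"
proof (rule homI)
  show "proj g \<in> carrier H" if "g \<in> carrier G" for g
    using that by (cases g) (auto simp: proj_def restrict0_def)
  show "proj (g \<otimes>\<^bsub>G\<^esub> h) = proj g \<otimes>\<^bsub>H\<^esub> proj h" for g h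
    using PW by (cases g; cases h) (auto simp: proj_def fun_eq_iff restrict0_def)
qed

lemma proj_id: "h \<in> carrier H \<Longrightarrow> proj h = h"
  by (cases h) (auto simp: proj_def restrict0_id simp del: lattice_group_simps)

lemma inclusion_hom: "(\<lambda>h. h) \<in> hom H G"
  using H_subset by (intro homI) (auto simp: H_mult)

context
  fixes \<phi> assumes \<phi>: "\<phi> \<in> iso G G"
begin

lemma \<phi>h: "\<phi> \<in> hom G G" using \<phi> iso_iff by blast

text \<open>The same function \<open>\<delta>\<close> is read on the lattice on \<open>U\<close> and
  on that on \<open>U \<union> W\<close>. Since \<open>\<phi>\<close> may multiply a generator from
  \<open>U\<close> by elements of the \<open>y\<close> lattice, \<open>\<psi>\<close> is formed by
  restricting to \<open>H\<close> and projecting back rather than by passing to a quotient of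
  \<open>G\<close>. \<open>\<psi>'\<close> is the action of \<open>\<psi>\<close> on the lattice on
  \<open>W\<close>.\<close>

abbreviation "\<delta> \<equiv> \<lambda>a. fst (\<phi> (a, \<lambda>_. 0))"
abbreviation "\<psi> \<equiv> \<lambda>h. proj (\<phi> h)"
abbreviation "\<psi>' \<equiv> \<lambda>a. restrict0 W (fst (\<phi> (a, \<lambda>_. 0)))"

lemma obtain_inverse:
  obtains \<phi>' where "\<phi>' \<in> iso G G" "\<And>g. g \<in> carrier G \<Longrightarrow> \<phi>' (\<phi> g) = g"
    "\<And>g. g \<in> carrier G \<Longrightarrow> \<phi> (\<phi>' g) = g"
proof
  show "inv_into (carrier G) \<phi> \<in> iso G G" using \<phi> group.iso_set_sym[OF group_nil2] by blast
qed (use \<phi> in \<open>simp_all add: iso_iff f_inv_into_f\<close>)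

lemma \<delta>_center: "a \<in> carrier (lattice_group U) \<Longrightarrow> \<delta> a \<in> carrier (lattice_group U)"
  by (rule image_center[OF \<phi>]) auto

lemma \<delta>_hom: "\<delta> \<in> hom (lattice_group U) (lattice_group U)"
proof (rule homI)
  show "\<delta> (x \<otimes>\<^bsub>lattice_group U\<^esub> y) = \<delta> x \<otimes>\<^bsub>lattice_group U\<^esub> \<delta> y"
    if "x \<in> carrier (lattice_group U)" "y \<in> carrier (lattice_group U)" for x y
    using hom_mult[OF G.ab_part_hom[OF \<phi>h]] that lattice_inclusion by simp
qed (rule \<delta>_center)

text \<open>If \<open>\<delta> a = 0\<close> then \<open>\<phi>\<close> sends
  \<open>(a, \<lambda>_. 0)\<close> into the \<open>y\<close> lattice, which \<open>\<phi>'\<close>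
  maps to itself, so \<open>a = 0\<close>. Surjectivity holds because \<open>\<phi>'\<close>
  preserves the centre as well.\<close>

lemma \<delta>_iso: "\<delta> \<in> iso (lattice_group U) (lattice_group U)"
proof -
  obtain \<phi>' where \<phi>': "\<phi>' \<in> iso G G" "\<And>g. g \<in> carrier G \<Longrightarrow> \<phi>' (\<phi> g) = g"
    "\<And>g. g \<in> carrier G \<Longrightarrow> \<phi> (\<phi>' g) = g" by (rule obtain_inverse) blast
  interpret \<delta>: group_hom "lattice_group U" "lattice_group U" \<delta>
    using \<delta>_hom by (intro group_hom.intro group_hom_axioms.intro group_lattice_group)
  have \<phi>'h: "\<phi>' \<in> hom G G" using \<phi>' iso_iff by blast
  have "inj_on \<delta> (carrier (lattice_group U))"
    unfolding \<delta>.inj_on_one_iff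
  proof (intro allI impI)
    fix a assume a: "a \<in> carrier (lattice_group U)" "\<delta> a = \<one>\<^bsub>lattice_group U\<^esub>"
    have c: "(a, \<lambda>_. 0) \<in> carrier G" using a by auto
    have eq: "\<phi> (a, \<lambda>_. 0) = (\<lambda>_. 0, snd (\<phi> (a, \<lambda>_. 0)))" using a by (simp add: prod_eq_iff)
    have "a = fst (\<phi>' (\<phi> (a, \<lambda>_. 0)))" using \<phi>'(2)[OF c] by simp
    also have "\<dots> = fst (\<phi>' (\<lambda>_. 0, snd (\<phi> (a, \<lambda>_. 0))))" by (subst eq) (rule refl)
    also have "\<dots> = (\<lambda>_. 0)"
      by (rule G.fst_comm[OF \<phi>'h]) (rule nil2_carrierD(2)[OF G.\<phi>_closed[OF \<phi>h c]])
    finally show "a = \<one>\<^bsub>lattice_group U\<^esub>" by simp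
  qed
  moreover have "carrier (lattice_group U) \<subseteq> \<delta> ` carrier (lattice_group U)"
  proof
    fix a assume a: "a \<in> carrier (lattice_group U)"
    have c: "(a, \<lambda>_. 0) \<in> carrier G" using a by auto
    have 1: "fst (\<phi>' (a, \<lambda>_. 0)) \<in> carrier (lattice_group U)"
      using image_center[OF \<phi>'(1) c] a by simp
    have 2: "\<delta> (fst (\<phi>' (a, \<lambda>_. 0))) = a"
      using G.fst_image[OF \<phi>h G.\<phi>_closed[OF \<phi>'h c]] \<phi>'(3)[OF c] by simp
    show "a \<in> \<delta> ` carrier (lattice_group U)" by (rule image_eqI[where f = \<delta>, OF 2[symmetric] 1])
  qed
  moreover have "\<delta> ` carrier (lattice_group U) \<subseteq> carrier (lattice_group U)"
    by (rule image_subsetI) (rule \<delta>_center)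
  ultimately show ?thesis unfolding iso_iff by (intro conjI \<delta>_hom subset_antisym)
qed

lemma \<psi>_hom: "\<psi> \<in> hom H H"
  using hom_compose[OF hom_compose[OF inclusion_hom \<phi>h] proj_hom] by (simp add: comp_def)

text \<open>If \<open>\<psi> h\<close> is trivial then \<open>\<phi> h\<close> is central, hence so
  is \<open>h\<close>; a central element of \<open>H\<close> lies in the \<open>y\<close> lattice,
  where the projection loses nothing, so \<open>\<phi> h\<close> is trivial. For surjectivity a
  preimage of \<open>h\<close> in \<open>G\<close> is split into its \<open>U\<close> part and an
  element of \<open>H\<close>.\<close>

lemma \<psi>_iso: "\<psi> \<in> iso H H"
proof -
  obtain \<phi>' where \<phi>': "\<phi>' \<in> iso G G" "\<And>g. g \<in> carrier G \<Longrightarrow> \<phi>' (\<phi> g) = g"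
    "\<And>g. g \<in> carrier G \<Longrightarrow> \<phi> (\<phi>' g) = g" by (rule obtain_inverse) blast
  interpret \<psi>: group_hom H H \<psi>
    using \<psi>_hom by (intro group_hom.intro group_hom_axioms.intro group_nil2)
  have \<phi>'h: "\<phi>' \<in> hom G G" using \<phi>' iso_iff by blast
  have "inj_on \<psi> (carrier H)"
    unfolding \<psi>.inj_on_one_iff
  proof (intro allI impI)
    fix h assume h: "h \<in> carrier H" "\<psi> h = \<one>\<^bsub>H\<^esub>"
    note hG = H_subset[OF h(1)]
    have res: "restrict0 W (fst (\<phi> h)) = (\<lambda>_. 0)" "snd (\<phi> h) = (\<lambda>_. 0)"
      using h(2) by (simp_all add: proj_def)
    then have "fst (\<phi> h) \<in> carrier (lattice_group U)"
      using restrict0_zero_iff[OF nil2_carrierD(1)[OF G.\<phi>_closed[OF \<phi>h hG]]] by blast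
    then have "fst h \<in> carrier (lattice_group U)"
      using image_center[OF \<phi>'(1) G.\<phi>_closed[OF \<phi>h hG]] \<phi>'(2)[OF hG] by simp
    then have "fst h = (\<lambda>_. 0)" using lattice_disjoint nil2_carrierD(1)[OF h(1)] by blast
    then have eq: "h = (\<lambda>_. 0, snd h)" by (simp add: prod_eq_iff)
    have "fst (\<phi> h) = (\<lambda>_. 0)"
      by (subst eq) (rule G.fst_comm[OF \<phi>h nil2_carrierD(2)[OF h(1)]])
    then have "\<phi> h = \<one>\<^bsub>G\<^esub>" using res by (simp add: prod_eq_iff)
    then have "h = \<phi>' \<one>\<^bsub>G\<^esub>" using \<phi>'(2)[OF hG] by simp
    also have "\<dots> = \<one>\<^bsub>G\<^esub>" using hom_one[OF \<phi>'h group_nil2 group_nil2] .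
    finally show "h = \<one>\<^bsub>H\<^esub>" by simp
  qed
  moreover have "carrier H \<subseteq> \<psi> ` carrier H"
  proof
    fix h assume h: "h \<in> carrier H"
    note hG = H_subset[OF h]
    obtain a b where ab: "\<phi>' h = (a, b)" by (cases "\<phi>' h")
    have abG: "(a, b) \<in> carrier G" using G.\<phi>_closed[OF \<phi>'h hG] ab by simp
    let ?u = "restrict0 U a" and ?w = "restrict0 W a"
    have uw: "(?u, \<lambda>_. 0) \<in> carrier G" "(?w, b) \<in> carrier H" using abG by (auto simp: restrict0_def)
    have "(a, b) = (?u, \<lambda>_. 0) \<otimes>\<^bsub>G\<^esub> (?w, b)"
      using abG disj PW by (auto simp: restrict0_def fun_eq_iff)
    then have "h = \<phi> (?u, \<lambda>_. 0) \<otimes>\<^bsub>G\<^esub> \<phi> (?w, b)"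
      using \<phi>'(3)[OF hG] ab G.\<phi>_mult[OF \<phi>h uw(1) H_subset[OF uw(2)]] by simp
    then have h_eq: "h = proj (\<phi> (?u, \<lambda>_. 0)) \<otimes>\<^bsub>H\<^esub> \<psi> (?w, b)"
      using proj_id[OF h] hom_mult[OF proj_hom G.\<phi>_closed[OF \<phi>h uw(1)] G.\<phi>_closed[OF \<phi>h H_subset[OF uw(2)]]]
      by simp
    \<comment> \<open>The \<open>U\<close> part of the preimage contributes only an element
      \<open>\<beta>\<close> of the \<open>y\<close> lattice. Its preimage \<open>b'\<close> under
      \<open>\<phi>\<close> is again in that lattice, thus in \<open>H\<close>, and can be absorbed
      into the argument of \<open>\<psi>\<close>.\<close>
    define \<beta> where "\<beta> = snd (\<phi> (?u, \<lambda>_. 0))"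
    have \<beta>: "\<beta> \<in> carrier (lattice_group P)"
      unfolding \<beta>_def by (rule nil2_carrierD(2)[OF G.\<phi>_closed[OF \<phi>h uw(1)]])
    have "fst (\<phi> (?u, \<lambda>_. 0)) \<in> carrier (lattice_group U)"
      by (rule \<delta>_center) (rule restrict0_closed)
    then have "restrict0 W (fst (\<phi> (?u, \<lambda>_. 0))) = (\<lambda>_. 0)"
      using restrict0_zero_iff[OF nil2_carrierD(1)[OF G.\<phi>_closed[OF \<phi>h uw(1)]]] by blast
    then have proj_u: "proj (\<phi> (?u, \<lambda>_. 0)) = (\<lambda>_. 0, \<beta>)" by (simp add: proj_def \<beta>_def)
    define b' where "b' = snd (\<phi>' (\<lambda>_. 0, \<beta>))"
    have \<beta>G: "(\<lambda>_. 0, \<beta>) \<in> carrier G" using \<beta> by simp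
    have b': "\<phi>' (\<lambda>_. 0, \<beta>) = (\<lambda>_. 0, b')"
      unfolding b'_def by (rule G.image_comm[OF \<phi>'h \<beta>])
    have b'c: "b' \<in> carrier (lattice_group P)"
      unfolding b'_def by (rule nil2_carrierD(2)[OF G.\<phi>_closed[OF \<phi>'h \<beta>G]])
    have "\<psi> (\<lambda>_. 0, b') = (\<lambda>_. 0, \<beta>)"
      using \<phi>'(3)[OF \<beta>G] b' by (simp add: proj_def restrict0_def)
    then have "h = \<psi> ((\<lambda>_. 0, b') \<otimes>\<^bsub>H\<^esub> (?w, b))"
      using h_eq proj_u hom_mult[OF \<psi>_hom _ uw(2), of "(\<lambda>_. 0, b')"] b'c by simp
    moreover have "(\<lambda>_. 0, b') \<otimes>\<^bsub>H\<^esub> (?w, b) \<in> carrier H"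
      by (rule monoid.m_closed[OF group.is_monoid[OF group_nil2] _ uw(2)]) (use b'c in simp)
    ultimately show "h \<in> \<psi> ` carrier H" by blast
  qed
  ultimately show ?thesis unfolding iso_iff using \<psi>.hom_closed by (intro conjI \<psi>_hom subset_antisym image_subsetI)
qed

lemma \<psi>'_hom: "\<psi>' \<in> hom (lattice_group W) (lattice_group W)"
  using H.ab_part_hom[OF \<psi>_hom] by (simp add: proj_def)

text \<open>\<open>\<delta>\<close> preserves the lattice on \<open>U\<close>, so it induces a map
  on the quotient, which is the lattice on \<open>W\<close>; this map is
  \<open>\<psi>'\<close>.\<close>

lemma \<psi>'_restrict0:
  assumes "a \<in> carrier (lattice_group (U \<union> W))"
  shows "\<psi>' (restrict0 W a) = restrict0 W (\<delta> a)"
proof -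
  have a: "a = (\<lambda>i. restrict0 U a i + restrict0 W a i)"
    using assms disj by (auto simp: restrict0_def fun_eq_iff)
  have "\<delta> a = (\<lambda>i. \<delta> (restrict0 U a) i + \<delta> (restrict0 W a) i)"
    by (subst a, subst lattice_hom_add[OF G.ab_part_hom[OF \<phi>h]]) (simp_all add: restrict0_def)
  then have "restrict0 W (\<delta> a) = (\<lambda>i. restrict0 W (\<delta> (restrict0 U a)) i + \<psi>' (restrict0 W a) i)"
    by (simp add: restrict0_add)
  moreover have "restrict0 W (\<delta> (restrict0 U a)) = (\<lambda>_. 0)"
    using restrict0_zero_iff \<delta>_center lattice_inclusion(1) restrict0_closed by blast
  ultimately show ?thesis by simp
qed

lemma restrict0_surj: "restrict0 W ` carrier (lattice_group (U \<union> W)) = carrier (lattice_group W)"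
proof (rule equalityI; rule subsetI)
  fix a assume "a \<in> carrier (lattice_group W)"
  then show "a \<in> restrict0 W ` carrier (lattice_group (U \<union> W))"
    by (intro image_eqI[where x = a] lattice_inclusion(2) restrict0_id[symmetric])
qed (use restrict0_closed in blast)

text \<open>A nonzero fixed vector of \<open>\<delta>\<close> on the lattice on \<open>U\<close>, or
  of \<open>\<psi>'\<close> on that on \<open>W\<close>, makes both sides infinite. Without such
  vectors every extension involved is multiplicative, and both sides become the product of the same
  three numbers, for the lattices on \<open>P\<close>, \<open>U\<close> and
  \<open>W\<close>.\<close>

lemma reidemeister_split:
  "reidemeister G \<phi> = reidemeister (lattice_group U) \<delta> * reidemeister H \<psi>"
proof -
  note \<delta>V_hom = G.ab_part_hom[OF \<phi>h]
  \<comment> \<open>In \<open>enat\<close> an infinite factor makes a product infinite only if the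
    other factor is nonzero.\<close>
  have nz: "reidemeister (lattice_group U) \<delta> \<noteq> 0" "reidemeister H \<psi> \<noteq> 0"
    by (rule reidemeister_nonzero[OF group_lattice_group \<delta>_hom])
      (rule reidemeister_nonzero[OF group_nil2 \<psi>_hom])
  have \<psi>_parts: "(\<lambda>a. fst (\<psi> (a, \<lambda>_. 0))) = \<psi>'" "(\<lambda>b. snd (\<psi> (\<lambda>_. 0, b))) = (\<lambda>b. snd (\<phi> (\<lambda>_. 0, b)))"
    by (simp_all add: proj_def)
  consider (U) a where "a \<in> carrier (lattice_group U)" "\<delta> a = a" "a \<noteq> (\<lambda>_. 0)"
    | (W) a where "a \<in> carrier (lattice_group W)" "\<psi>' a = a" "a \<noteq> (\<lambda>_. 0)"
    | (none) "\<And>a. \<lbrakk>a \<in> carrier (lattice_group U); \<delta> a = a\<rbrakk> \<Longrightarrow> a = (\<lambda>_. 0)"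
      "\<And>a. \<lbrakk>a \<in> carrier (lattice_group W); \<psi>' a = a\<rbrakk> \<Longrightarrow> a = (\<lambda>_. 0)"
    by blast
  then show ?thesis
  proof cases
    case U
    have "reidemeister (lattice_group U) \<delta> = \<infinity>"
      by (rule reidemeister_lattice_infinite[OF finU \<delta>_hom U])
    moreover have "reidemeister (lattice_group (U \<union> W)) \<delta> = \<infinity>"
      by (rule reidemeister_lattice_infinite[OF G.finV \<delta>V_hom lattice_inclusion(1)[OF U(1)] U(2,3)])
    then have "reidemeister G \<phi> = \<infinity>" by (rule G.reidemeister_nil2_infinite[OF \<phi>h])
    ultimately show ?thesis using nz by (simp add: imult_infinity)
  next
    case W
    have inf: "reidemeister (lattice_group W) \<psi>' = \<infinity>"
      by (rule reidemeister_lattice_infinite[OF finW \<psi>'_hom W])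
    then have "reidemeister H \<psi> = \<infinity>"
      using H.reidemeister_nil2_infinite[OF \<psi>_hom] by (simp add: \<psi>_parts)
    \<comment> \<open>The fixed vector of \<open>\<psi>'\<close> need not lift to one of
      \<open>\<delta>\<close>, so infinity is pulled back along the quotient map
      \<open>restrict0 W\<close>.\<close>
    moreover have "reidemeister (lattice_group (U \<union> W)) \<delta> = \<infinity>"
      by (rule reidemeister_quotient_infinite[where \<pi> = "restrict0 W" and \<kappa> = \<psi>', OF group_lattice_group group_lattice_group \<delta>V_hom \<psi>'_hom
            restrict0_hom restrict0_surj _ inf]) (simp add: \<psi>'_restrict0)
    then have "reidemeister G \<phi> = \<infinity>" by (rule G.reidemeister_nil2_infinite[OF \<phi>h])
    ultimately show ?thesis using nz by (simp add: imult_infinity_right)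
  next
    case none
    \<comment> \<open>A fixed vector of \<open>\<delta>\<close> restricts to one of
      \<open>\<psi>'\<close>, which is 0; the vector is then supported on \<open>U\<close> and
      vanishes too.\<close>
    have fixV: "a = (\<lambda>_. 0)" if a: "a \<in> carrier (lattice_group (U \<union> W))" "\<delta> a = a" for a
    proof -
      have "\<psi>' (restrict0 W a) = restrict0 W a" using \<psi>'_restrict0[OF a(1)] a(2) by simp
      then have "restrict0 W a = (\<lambda>_. 0)" using none(2) restrict0_closed by blast
      then show ?thesis using restrict0_zero_iff[OF a(1)] none(1) a(2) by blast
    qed
    have "reidemeister (lattice_group (U \<union> W)) \<delta> =
        reidemeister (lattice_group U) \<delta> * reidemeister (lattice_group W) \<psi>'"
    proof (rule reidemeister_central_extension[where \<iota> = "\<lambda>a. a" and \<pi> = "restrict0 W"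
            and \<phi> = \<delta> and \<nu> = \<delta> and \<kappa> = \<psi>',
          OF group_lattice_group group_lattice_group comm_group_lattice_group _ _ restrict0_hom restrict0_surj _ _ \<delta>_hom \<delta>V_hom \<psi>'_hom])
      show "(\<lambda>a. a) \<in> hom (lattice_group U) (lattice_group (U \<union> W))" by (rule homI) auto
      show "(\<lambda>a. a) ` carrier (lattice_group U) =
          kernel (lattice_group (U \<union> W)) (lattice_group W) (restrict0 W)"
        using restrict0_zero_iff lattice_inclusion(1) by (auto simp: kernel_def simp del: lattice_group_simps(1))
      show "q = \<one>\<^bsub>lattice_group W\<^esub>" if "q \<in> carrier (lattice_group W)" "\<psi>' q = q" for q
        using none(2)[OF that] by simp
    qed (simp_all add: \<psi>'_restrict0 add.commute)
    moreover have "reidemeister G \<phi> = reidemeister (lattice_group P) (\<lambda>b. snd (\<phi> (\<lambda>_. 0, b))) *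
        reidemeister (lattice_group (U \<union> W)) \<delta>"
      using fixV by (rule G.reidemeister_nil2[OF \<phi>h])
    \<comment> \<open>The projection does not touch the \<open>y\<close> coordinates, so
      \<open>\<phi>\<close> and \<open>\<psi>\<close> induce the same map on the lattice on
      \<open>P\<close>.\<close>
    moreover have "reidemeister H \<psi> = reidemeister (lattice_group P) (\<lambda>b. snd (\<phi> (\<lambda>_. 0, b))) *
        reidemeister (lattice_group W) \<psi>'"
      by (rule H.reidemeister_nil2[OF \<psi>_hom, unfolded \<psi>_parts], rule none(2))
        (assumption, simp add: proj_def)
    ultimately show ?thesis by (simp add: ac_simps)
  qed
qed

end

text \<open>No pair in \<open>P\<close> meets \<open>U\<close>, so multiplying by
  \<open>(u, \<lambda>_. 0)\<close> merely adds coordinates. The inverse sorts the coordinates by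
  support.\<close>

lemma DirProd_iso:
  "(\<lambda>(u, h). (u, \<lambda>_. 0) \<otimes>\<^bsub>G\<^esub> h) \<in> iso (lattice_group U \<times>\<times> H) G"
proof -
  let ?f = "\<lambda>(u, h). (u, \<lambda>_. 0) \<otimes>\<^bsub>G\<^esub> h"
  have zero: "u (snd p) = 0" "u (fst p) = 0" if "u \<in> carrier (lattice_group U)" "p \<in> P" for u p
  proof -
    have "snd p \<notin> U" "fst p \<notin> U" using subsetD[OF PW that(2)] disj by (auto simp: mem_Times_iff)
    then show "u (snd p) = 0" "u (fst p) = 0" using that(1) by simp_all
  qed
  have f: "?f (u, (a, b)) = (\<lambda>i. u i + a i, b)" if "u \<in> carrier (lattice_group U)" for u a b
    using zero[OF that] by (auto simp: fun_eq_iff)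
  have dest: "\<exists>u a b. x = (u, (a, b)) \<and> u \<in> carrier (lattice_group U) \<and>
      a \<in> carrier (lattice_group W) \<and> b \<in> carrier (lattice_group P)"
    if "x \<in> carrier (lattice_group U \<times>\<times> H)" for x
    using that by (cases x, cases "snd x") (auto simp del: lattice_group_simps)
  have closed: "?f x \<in> carrier G" if "x \<in> carrier (lattice_group U \<times>\<times> H)" for x
    using dest[OF that] f by (elim exE conjE) (simp del: case_prod_conv)
  have "?f \<in> hom (lattice_group U \<times>\<times> H) G"
  proof (rule homI[OF closed])
    fix x y assume "x \<in> carrier (lattice_group U \<times>\<times> H)" "y \<in> carrier (lattice_group U \<times>\<times> H)"
    then obtain u a b u' a' b' where
      xy: "x = (u, (a, b))" "y = (u', (a', b'))"
      and u: "u \<in> carrier (lattice_group U)" "u' \<in> carrier (lattice_group U)"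
      using dest by meson
    have "(\<lambda>i. u i + u' i) \<in> carrier (lattice_group U)" using u by simp
    then have "?f (x \<otimes>\<^bsub>lattice_group U \<times>\<times> H\<^esub> y) = (\<lambda>i. (u i + u' i) + (a i + a' i),
        \<lambda>p. b p + b' p + of_bool (p \<in> P) * (a (snd p) * a' (fst p)))"
      unfolding xy mult_DirProd nil2_simps lattice_group_simps(2) by (rule f)
    also have "\<dots> = (\<lambda>i. u i + a i, b) \<otimes>\<^bsub>G\<^esub> (\<lambda>i. u' i + a' i, b')"
      using zero[OF u(1)] zero[OF u(2)] by (simp add: fun_eq_iff)
    also have "\<dots> = ?f x \<otimes>\<^bsub>G\<^esub> ?f y" unfolding xy f[OF u(1)] f[OF u(2)] ..
    finally show "?f (x \<otimes>\<^bsub>lattice_group U \<times>\<times> H\<^esub> y) = ?f x \<otimes>\<^bsub>G\<^esub> ?f y" .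
  qed
  moreover have "bij_betw ?f (carrier (lattice_group U \<times>\<times> H)) (carrier G)"
  proof (rule bij_betwI[where g = "\<lambda>g. (restrict0 U (fst g), proj g)"])
    show "?f \<in> carrier (lattice_group U \<times>\<times> H) \<rightarrow> carrier G" using closed by blast
    show "(\<lambda>g. (restrict0 U (fst g), proj g)) \<in> carrier G \<rightarrow> carrier (lattice_group U \<times>\<times> H)"
      using hom_in_carrier[OF proj_hom] restrict0_closed by (auto simp del: lattice_group_simps)
    fix x assume "x \<in> carrier (lattice_group U \<times>\<times> H)"
    then obtain u a b where x: "x = (u, (a, b))" "u \<in> carrier (lattice_group U)"
      "a \<in> carrier (lattice_group W)"
      using dest by meson
    have "restrict0 U (\<lambda>i. u i + a i) = u" "restrict0 W (\<lambda>i. u i + a i) = a"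
      using x disj by (auto simp: restrict0_def fun_eq_iff)
    then show "(restrict0 U (fst (?f x)), proj (?f x)) = x"
      unfolding x(1) f[OF x(2)] by (simp add: proj_def)
  next
    fix g assume "g \<in> carrier G"
    then obtain a b where g: "g = (a, b)" "a \<in> carrier (lattice_group (U \<union> W))" by (cases g) auto
    have "(\<lambda>i. restrict0 U a i + restrict0 W a i) = a"
      using g disj by (auto simp: restrict0_def fun_eq_iff)
    then show "?f (restrict0 U (fst g), proj g) = g"
      unfolding g(1) proj_def fst_conv snd_conv f[OF restrict0_closed] by simp
  qed
  ultimately show ?thesis by (simp add: iso_def)
qed

text \<open>Each \<open>\<phi>\<close> yields the pair \<open>\<delta>\<close>,
  \<open>\<psi>\<close> with the required product; conversely a pair of automorphisms is realised by
  its direct product.\<close>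

lemma spec_R_nil2:
  "spec_R G = set_times_inf (spec_R (lattice_group U)) (spec_R H)"
proof
  show "spec_R G \<subseteq> set_times_inf (spec_R (lattice_group U)) (spec_R H)"
    unfolding set_times_inf_spec_R[OF group_lattice_group group_nil2]
    using reidemeister_split \<delta>_iso \<psi>_iso unfolding spec_R_def by blast
  have "spec_R (lattice_group U \<times>\<times> H) = spec_R G"
    using spec_R_cong_iso[OF DirProd_group[OF group_lattice_group group_nil2] group_nil2 DirProd_iso] .
  then show "set_times_inf (spec_R (lattice_group U)) (spec_R H) \<subseteq> spec_R G"
    using set_times_inf_spec_R_subset[OF group_lattice_group group_nil2] by metis
qed

end

section \<open>Presented groups\<close>

text \<open>Abstract because it serves three times: for equality in the presented group, for the
  same relation on words in the \<open>y\<close> only, and for equality modulo the \<open>y\<close>.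
  The last relates only words over \<open>S\<close>, hence the restrictions to
  \<open>lists (UNIV \<times> S)\<close>.\<close>

locale word_congruence =
  fixes S :: "'g set" and Q :: "'g word \<Rightarrow> 'g word \<Rightarrow> bool"
  assumes refl: "w \<in> lists (UNIV \<times> S) \<Longrightarrow> Q w w"
    and sym: "Q u v \<Longrightarrow> Q v u"
    and trans [trans]: "\<lbrakk>Q u v; Q v w\<rbrakk> \<Longrightarrow> Q u w"
    and cong: "\<lbrakk>Q u v; p \<in> lists (UNIV \<times> S); q \<in> lists (UNIV \<times> S)\<rbrakk> \<Longrightarrow> Q (p @ u @ q) (p @ v @ q)"
    and cancel: "g \<in> S \<Longrightarrow> Q [(b, g), (\<not> b, g)] []"
begin

abbreviation "L \<equiv> lists ((UNIV :: bool set) \<times> S)"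

lemma cancel_mid:
  assumes "g \<in> S" "p \<in> L" "q \<in> L"
  shows "Q (p @ [(b, g), (\<not> b, g)] @ q) (p @ q)"
  using cong[OF cancel[OF assms(1)] assms(2,3)] by simp

lemma commute_inverse:
  assumes "g \<in> S" "l \<in> UNIV \<times> S" and c: "Q [(b, g), l] [l, (b, g)]"
  shows "Q [(\<not> b, g), l] [l, (\<not> b, g)]"
proof -
  have "Q [(\<not> b, g), l] ([(\<not> b, g), l] @ [(b, g), (\<not> b, g)] @ [])"
    by (rule sym) (use cancel_mid[OF assms(1), of "[(\<not> b, g), l]" "[]" b] assms in simp)
  also have "Q \<dots> ([(\<not> b, g)] @ [(b, g), l] @ [(\<not> b, g)])"
    using cong[OF sym[OF c], of "[(\<not> b, g)]" "[(\<not> b, g)]"] assms by simp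
  also have "Q \<dots> [l, (\<not> b, g)]"
    using cancel_mid[OF assms(1), of "[]" "[l, (\<not> b, g)]" "\<not> b"] assms by simp
  finally show ?thesis .
qed

lemma commute_signs:
  assumes g: "g \<in> S" "h \<in> S" and c: "Q [(True, g), (True, h)] [(True, h), (True, g)]"
  shows "Q [(b, g), (d, h)] [(d, h), (b, g)]"
proof -
  have 1: "Q [(b, g), (True, h)] [(True, h), (b, g)]"
    using commute_inverse[OF g(1) _ c] c g by (cases b) auto
  show ?thesis
    using sym[OF commute_inverse[OF g(2) _ sym[OF 1]]] 1 g by (cases d) auto
qed

lemma commute_word:
  assumes "l \<in> UNIV \<times> S" "p \<in> L" "\<And>m. m \<in> set p \<Longrightarrow> Q [l, m] [m, l]"
  shows "Q (l # p) (p @ [l])"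
  using assms(2,3)
proof (induction p rule: list.induct)
  case Nil
  then show ?case using assms(1) refl by simp
next
  case (Cons m p)
  have m: "[m] \<in> L" and p: "p \<in> L" using Cons.prems(1) by auto
  have "Q (l # m # p) (m # l # p)"
    using cong[OF Cons.prems(2)[of m] _ p, of "[]"] by simp
  also have "Q \<dots> (m # p @ [l])"
    using cong[OF Cons.IH m, of "[]"] p Cons.prems(2) by simp
  finally show ?case by simp
qed

lemma commute_words:
  assumes "p \<in> L" "q \<in> L" "\<And>l m. \<lbrakk>l \<in> set p; m \<in> set q\<rbrakk> \<Longrightarrow> Q [l, m] [m, l]"
  shows "Q (p @ q) (q @ p)"
  using assms(1,3)
proof (induction p rule: list.induct)
  case Nil
  then show ?case using assms(2) refl by simp
next
  case (Cons l p)
  have l: "l \<in> UNIV \<times> S" "[l] \<in> L" and p: "p \<in> L" using Cons.prems(1) by auto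
  have "Q (l # p @ q) (l # q @ p)"
    using cong[OF Cons.IH l(2), of "[]"] p Cons.prems(2) by simp
  also have "Q \<dots> (q @ l # p)"
    using cong[OF commute_word[OF l(1) assms(2)] _ p, of "[]"] Cons.prems(2) by simp
  finally show ?case by simp
qed

text \<open>Prefixing \<open>h g\<close> to the relator \<open>g^-1 h^-1 g h c\<close> and
  cancelling leaves \<open>g h c = h g\<close>.\<close>

lemma commutator_relation:
  assumes "g \<in> S" "h \<in> S" "c \<in> L" and r: "Q (comm_word [(True, g)] [(True, h)] @ c) []"
  shows "Q ([(True, g), (True, h)] @ c) [(True, h), (True, g)]"
proof -
  let ?w = "[(False, h), (True, g), (True, h)] @ c"
  have "Q ([(True, h)] @ [(True, g), (False, g)] @ ?w) [(True, h), (True, g)]"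
    using cong[OF r, of "[(True, h), (True, g)]" "[]"] assms by (simp add: comm_word_def word_inv_def)
  moreover have "Q ([(True, h)] @ [(True, g), (False, g)] @ ?w) ([(True, h)] @ ?w)"
    using cancel_mid[OF assms(1), of "[(True, h)]" ?w True] assms by simp
  moreover have "Q ([(True, h)] @ ?w) ([(True, g), (True, h)] @ c)"
    using cancel_mid[OF assms(2), of "[]" "[(True, g), (True, h)] @ c" True] assms by simp
  ultimately show ?thesis using sym trans by blast
qed

lemma word_inv_closed: "w \<in> L \<Longrightarrow> word_inv w \<in> L"
  by (auto simp: word_inv_def)

lemma word_inv_right: "w \<in> L \<Longrightarrow> Q (w @ word_inv w) []"
proof (induction w)
  case Nil
  then show ?case using refl by (simp add: word_inv_def)
next
  case (Cons l w)
  obtain b g where l: "l = (b, g)" by (cases l)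
  have g: "g \<in> S" using Cons.prems l by simp
  have "Q ([l] @ (w @ word_inv w) @ [(\<not> b, g)]) ([l] @ [] @ [(\<not> b, g)])"
    by (rule cong[OF Cons.IH]) (use Cons.prems l in auto)
  also have "Q \<dots> []" using cancel[OF g] by (simp add: l)
  finally show ?case by (simp add: l word_inv_def)
qed

lemma word_inv_left: "w \<in> L \<Longrightarrow> Q (word_inv w @ w) []"
proof -
  have "word_inv (word_inv w) = w"
    by (induction w) (auto simp: word_inv_def)
  then show "w \<in> L \<Longrightarrow> Q (word_inv w @ w) []"
    using word_inv_right[OF word_inv_closed] by metis
qed

end

lemma pres_eq_append: "pres_eq S R u v \<Longrightarrow> pres_eq S R (p @ u @ q) (p @ v @ q)"
proof (induction rule: pres_eq.induct)
  case (pe_cancel g u b w)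
  show ?case using pres_eq.pe_cancel[OF pe_cancel, of R "p @ u" b "w @ q"] by simp
next
  case (pe_rel r u w)
  show ?case using pres_eq.pe_rel[OF pe_rel, of S "p @ u" "w @ q"] by simp
qed (blast intro: pe_refl pe_sym pe_trans)+

lemma pres_eq_word_congruence: "S' \<subseteq> S \<Longrightarrow> word_congruence S' (pres_eq S R)"
proof
  show "pres_eq S R [(b, g), (\<not> b, g)] []" if "S' \<subseteq> S" "g \<in> S'" for b g
    using pe_cancel[of g S R "[]" b "[]"] that by auto
qed (blast intro: pe_refl pe_sym pe_trans pres_eq_append)+

definition expsum :: "'g \<Rightarrow> 'g word \<Rightarrow> int" where
  "expsum g w = (\<Sum>(b, h)\<leftarrow>w. if h = g then if b then 1 else -1 else 0)"

lemma expsum_simps [simp]: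
  "expsum g [] = 0"
  "expsum g ((b, h) # w) = (if h = g then if b then 1 else -1 else 0) + expsum g w"
  "expsum g (u @ v) = expsum g u + expsum g v"
  by (simp_all add: expsum_def)

lemma expsum_nonneg: "(False, g) \<notin> set w \<Longrightarrow> expsum g w \<ge> 0"
  by (induction w) auto

lemma expsum_nonpos: "(True, g) \<notin> set w \<Longrightarrow> expsum g w \<le> 0"
  by (induction w) auto

text \<open>Induction on the length. A first letter from \<open>T\<close> is dropped; any other has
  its inverse further right, since the exponent sum is 0, and is moved there and cancelled.\<close>

lemma (in word_congruence) trivial_of_expsum_zero:
  assumes comm: "\<And>l m. \<lbrakk>l \<in> UNIV \<times> S; m \<in> UNIV \<times> S\<rbrakk> \<Longrightarrow> Q [l, m] [m, l]"
    and kill: "\<And>b g. g \<in> T \<Longrightarrow> Q [(b, g)] []"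
    and "w \<in> L" "\<And>g. g \<in> S - T \<Longrightarrow> expsum g w = 0"
  shows "Q w []"
  using assms(3,4)
proof (induction w rule: length_induct)
  case (1 w)
  show ?case
  proof (cases w)
    case Nil
    then show ?thesis using refl by simp
  next
    case (Cons l w')
    obtain b g where l: "l = (b, g)" by (cases l)
    have w': "w' \<in> L" "g \<in> S" using "1.prems"(1) Cons l by auto
    show ?thesis
    proof (cases "g \<in> T")
      case True
      have "Q w w'" using cong[OF kill[OF True], of "[]" w' b] w' by (simp add: Cons l)
      moreover have "expsum h w' = 0" if "h \<in> S - T" for h
        using "1.prems"(2)[OF that] True that by (cases "g = h") (auto simp: Cons l)
      then have "Q w' []" using "1.IH" w' by (simp add: Cons)
      ultimately show ?thesis by (rule trans)
    next
      case False
      have "(if b then 1 else -1) + expsum g w' = 0"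
        using "1.prems"(2)[of g] False w' by (simp add: Cons l)
      then have "(\<not> b, g) \<in> set w'"
        using expsum_nonneg[of g w'] expsum_nonpos[of g w'] by (cases b) fastforce+
      then obtain p q where pq: "w' = p @ (\<not> b, g) # q" by (meson split_list)
      have L: "p \<in> L" "q \<in> L" using w' pq by auto
      have "Q ([] @ ((b, g) # p) @ ((\<not> b, g) # q)) ([] @ (p @ [(b, g)]) @ ((\<not> b, g) # q))"
        by (intro cong commute_word comm) (use L w' in auto)
      also have "Q \<dots> (p @ q)" using cancel_mid[OF w'(2) L] by simp
      also have "Q \<dots> []"
      proof -
        have "expsum h (p @ q) = 0" if "h \<in> S - T" for h
          using "1.prems"(2)[OF that] by (auto simp: Cons l pq split: if_splits)
        then show ?thesis using "1.IH" L by (simp add: Cons pq)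
      qed
      finally show ?thesis by (simp add: Cons l pq)
    qed
  qed
qed

section \<open>Evaluating words in a group and recognising a presentation\<close>

locale word_eval = group K for K (structure) +
  fixes f :: "'g \<Rightarrow> 'a"
  assumes f_closed [simp]: "f g \<in> carrier K"
begin

fun weval :: "'g word \<Rightarrow> 'a" where
  "weval [] = \<one>"
| "weval ((b, g) # w) = (if b then f g else inv (f g)) \<otimes> weval w"

lemma weval_closed [simp]: "weval w \<in> carrier K"
  by (induction w rule: weval.induct) auto

lemma weval_append [simp]: "weval (u @ v) = weval u \<otimes> weval v"
  by (induction u rule: weval.induct) (auto simp: m_assoc)

lemma weval_word_inv [simp]: "weval (word_inv w) = inv (weval w)"
  by (induction w rule: weval.induct) (auto simp: word_inv_def inv_mult_group)

lemma weval_pres_eq: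
  assumes "pres_eq S R u v" "\<And>r. r \<in> R \<Longrightarrow> weval r = \<one>"
  shows "weval u = weval v"
  using assms
proof (induction rule: pres_eq.induct)
  case (pe_cancel g u b w)
  have "weval [(b, g), (\<not> b, g)] = \<one>" by simp
  then show ?case unfolding weval_append by (simp del: weval.simps)
qed simp_all

text \<open>The hypotheses say that evaluation is well defined on the presented group, onto, and has
  trivial kernel. As elements of that group are sets of words, the isomorphism is written from
  \<open>K\<close> to it, sending \<open>k\<close> to the fibre of \<open>weval\<close> over
  \<open>k\<close>.\<close>

lemma presented_group_iso:
  assumes rel: "\<And>r. r \<in> R \<Longrightarrow> weval r = \<one>"
    and surj: "\<And>k. k \<in> carrier K \<Longrightarrow> \<exists>w\<in>lists (UNIV \<times> S). weval w = k"
    and inj: "\<And>w. \<lbrakk>w \<in> lists (UNIV \<times> S); weval w = \<one>\<rbrakk> \<Longrightarrow> pres_eq S R w []"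
  shows "(\<lambda>k. {w \<in> lists (UNIV \<times> S). weval w = k}) \<in> iso K (presented_group S R)"
    and "group (presented_group S R)"
proof -
  interpret word_congruence S "pres_eq S R" by (rule pres_eq_word_congruence) simp
  let ?c = "\<lambda>k. {w \<in> L. weval w = k}"
  let ?D = "presented_group S R"
  have eq_iff: "pres_eq S R u v \<longleftrightarrow> weval u = weval v" if "u \<in> L" "v \<in> L" for u v
  proof
    assume "weval u = weval v"
    then have "pres_eq S R (u @ word_inv v) []"
      using that word_inv_closed by (intro inj) auto
    from pres_eq_append[OF this, of "[]" v] have "pres_eq S R (u @ word_inv v @ v) v" by simp
    moreover have "pres_eq S R (u @ word_inv v @ v) u"
      using pres_eq_append[OF word_inv_left[OF that(2)], of u "[]"] by simp
    ultimately show "pres_eq S R u v" using sym trans by blast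
  qed (use weval_pres_eq rel in blast)
  have cls: "pres_class S R w = ?c (weval w)" if "w \<in> L" for w
    unfolding pres_class_def by (intro Collect_cong conj_cong HOL.refl) (metis eq_iff that)
  have carr: "?c ` carrier K = carrier ?D"
  proof (intro subset_antisym subsetI)
    fix C assume "C \<in> ?c ` carrier K"
    then obtain k where k: "k \<in> carrier K" "C = ?c k" by auto
    then obtain w where "w \<in> L" "weval w = k" using surj by blast
    then have "C = pres_class S R w" using cls k by simp
    then show "C \<in> carrier ?D" using \<open>w \<in> L\<close> by (simp add: presented_group_def)
  next
    fix C assume "C \<in> carrier ?D"
    then obtain w where "w \<in> L" "C = pres_class S R w" by (auto simp: presented_group_def)
    then show "C \<in> ?c ` carrier K" using cls[of w] weval_closed by blast
  qed
  have mult: "?c (k \<otimes> k') = ?c k \<otimes>\<^bsub>?D\<^esub> ?c k'" if k: "k \<in> carrier K" "k' \<in> carrier K" for k k'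
  proof -
    obtain u v where uv: "u \<in> L" "weval u = k" "v \<in> L" "weval v = k'" using surj k by blast
    have "w \<in> ?c (k \<otimes> k') \<longleftrightarrow> w \<in> L \<and> (\<exists>a\<in>?c k. \<exists>b\<in>?c k'. pres_eq S R (a @ b) w)" for w
    proof
      assume "w \<in> ?c (k \<otimes> k')"
      then have w: "w \<in> L" "weval w = k \<otimes> k'" by auto
      then have "pres_eq S R (u @ v) w" using uv eq_iff[of "u @ v" w] by simp
      then show "w \<in> L \<and> (\<exists>a\<in>?c k. \<exists>b\<in>?c k'. pres_eq S R (a @ b) w)" using w uv by blast
    next
      assume "w \<in> L \<and> (\<exists>a\<in>?c k. \<exists>b\<in>?c k'. pres_eq S R (a @ b) w)"
      then obtain a b where "w \<in> L" "a \<in> ?c k" "b \<in> ?c k'" "pres_eq S R (a @ b) w" by blast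
      then show "w \<in> ?c (k \<otimes> k')" using eq_iff[of "a @ b" w] by auto
    qed
    then show ?thesis unfolding presented_group_def monoid.select_convs by blast
  qed
  have "inj_on ?c (carrier K)"
  proof (rule inj_onI)
    fix k k' assume k: "k \<in> carrier K" "k' \<in> carrier K" "?c k = ?c k'"
    obtain w where "w \<in> L" "weval w = k" using surj k(1) by blast
    then have "w \<in> ?c k'" using k(3) by blast
    then show "k = k'" using \<open>weval w = k\<close> by simp
  qed
  moreover have hom: "?c \<in> hom K ?D"
    by (rule homI) (use carr in blast, rule mult)
  ultimately show "?c \<in> iso K ?D" using carr by (simp add: iso_iff)
  \<comment> \<open>The image of a group under a homomorphism is a group with the image of
    \<open>\<one>\<close> as unit, and that image is the class of the empty word.\<close>
  have "pres_class S R [] = ?c \<one>" using cls[of "[]"] by simp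
  then have "?D\<lparr>one := ?c \<one>\<rparr> = ?D" by (simp add: presented_group_def)
  then show "group ?D"
    using hom_imp_img_group[OF hom] unfolding carr by simp
qed

end

section \<open>The groups of graphs\<close>

definition nonedges :: "nat set \<Rightarrow> (nat \<Rightarrow> nat \<Rightarrow> bool) \<Rightarrow> (nat \<times> nat) set" where
  "nonedges V E = {(i, j). i \<in> V \<and> j \<in> V \<and> i < j \<and> \<not> E i j}"

locale graph =
  fixes V :: "nat set" and E :: "nat \<Rightarrow> nat \<Rightarrow> bool"
  assumes finV: "finite V" and E_sym: "E i j \<Longrightarrow> E j i"
begin

abbreviation "P \<equiv> nonedges V E"
abbreviation "K \<equiv> nil2 V P"
abbreviation "S \<equiv> GGamma_gens V E"
abbreviation "Y \<equiv> {GY i j | i j. (i, j) \<in> P}"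
abbreviation "R \<equiv> GGamma_rels V E"

lemma finite_P: "finite P"
  by (rule finite_subset[of _ "V \<times> V"]) (auto simp: nonedges_def finV)

lemma S_eq: "S = GX ` V \<union> Y"
  by (auto simp: GGamma_gens_def nonedges_def)

text \<open>Symbols that are not generators are sent to the identity, because
  \<open>word_eval\<close> requires a value in the carrier for every symbol.\<close>

definition geval :: "gen \<Rightarrow> (nat \<Rightarrow> int) \<times> (nat \<times> nat \<Rightarrow> int)" where
  "geval g = (case g of
      GX i \<Rightarrow> if i \<in> V then (unit_vec i, \<lambda>_. 0) else (\<lambda>_. 0, \<lambda>_. 0)
    | GY i j \<Rightarrow> if (i, j) \<in> P then (\<lambda>_. 0, unit_vec (i, j)) else (\<lambda>_. 0, \<lambda>_. 0))"

sublocale word_eval K geval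
proof (rule word_eval.intro[OF group_nil2], unfold_locales)
  show "geval g \<in> carrier K" for g by (auto simp: geval_def split: gen.split)
qed

lemma inv_geval:
  "i \<in> V \<Longrightarrow> inv\<^bsub>K\<^esub> (geval (GX i)) = (\<lambda>j. - unit_vec i j, \<lambda>_. 0)"
  "(i, j) \<in> P \<Longrightarrow> inv\<^bsub>K\<^esub> (geval (GY i j)) = (\<lambda>_. 0, \<lambda>p. - unit_vec (i, j) p)"
  by (rule inv_equality; auto simp: geval_def fun_eq_iff nonedges_def)+

text \<open>Multiplying by \<open>v u\<close> on the left removes the inverses, so relators can be
  checked as equations between products.\<close>

lemma weval_comm_word:
  "weval (comm_word u v @ w) = \<one>\<^bsub>K\<^esub> \<longleftrightarrow> weval u \<otimes>\<^bsub>K\<^esub> weval v \<otimes>\<^bsub>K\<^esub> weval w = weval v \<otimes>\<^bsub>K\<^esub> weval u"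
proof -
  have "weval (comm_word u v @ w) =
      inv\<^bsub>K\<^esub> (weval v \<otimes>\<^bsub>K\<^esub> weval u) \<otimes>\<^bsub>K\<^esub> (weval u \<otimes>\<^bsub>K\<^esub> weval v \<otimes>\<^bsub>K\<^esub> weval w)"
    unfolding comm_word_def weval_append weval_word_inv by (simp only: inv_mult_group weval_closed m_assoc m_closed inv_closed)
  then show ?thesis
    using inv_solve_left[OF one_closed, of "weval v \<otimes>\<^bsub>K\<^esub> weval u" "weval u \<otimes>\<^bsub>K\<^esub> weval v \<otimes>\<^bsub>K\<^esub> weval w"]
    by (metis m_closed r_one weval_closed)
qed

lemma weval_relator:
  assumes "r \<in> R"
  shows "weval r = \<one>\<^bsub>K\<^esub>"
proof -
  \<comment> \<open>The trailing \<open>[]\<close> gives every relator the shape that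
    \<open>weval_comm_word\<close> expects.\<close>
  consider (XX) i j where "i \<in> V" "j \<in> V" "E i j" "r = comm_word [(True, GX j)] [(True, GX i)] @ []"
    | (XY) i j where "(i, j) \<in> P" "r = comm_word [(True, GX j)] [(True, GX i)] @ [(False, GY i j)]"
    | (Y) l i j where "l \<in> V" "(i, j) \<in> P" "r = comm_word [(True, GX l)] [(True, GY i j)] @ []"
    using assms by (auto simp: GGamma_rels_def nonedges_def)
  then show ?thesis
  proof cases
    case XX
    then have "(i, j) \<notin> P" "(j, i) \<notin> P" using E_sym by (auto simp: nonedges_def)
    then show ?thesis using XX unfolding XX(4) weval_comm_word by (auto simp: geval_def fun_eq_iff)
  next
    case XY
    then have "i \<in> V" "j \<in> V" "(j, i) \<notin> P" by (auto simp: nonedges_def)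
    then show ?thesis using XY(1) unfolding XY(2) weval_comm_word
      by (auto simp: inv_geval(2)) (auto simp: geval_def fun_eq_iff)
  next
    case Y
    then show ?thesis unfolding Y(3) weval_comm_word by (auto simp: geval_def fun_eq_iff)
  qed
qed

text \<open>Products of the \<open>x\<close> create \<open>y\<close> coordinates along the way, so
  only the first component is prescribed at first. The second is then corrected by an element of the
  \<open>y\<close> lattice, all of which is attained.\<close>

lemma weval_surj:
  assumes "k \<in> carrier K"
  shows "\<exists>w\<in>lists (UNIV \<times> S). weval w = k"
proof -
  define D where "D = weval ` lists (UNIV \<times> S)"
  have mult: "x \<otimes>\<^bsub>K\<^esub> y \<in> D" if xy: "x \<in> D" "y \<in> D" for x y
  proof -
    obtain u v where "u \<in> lists (UNIV \<times> S)" "v \<in> lists (UNIV \<times> S)" "x = weval u" "y = weval v"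
      using xy unfolding D_def by blast
    then show ?thesis unfolding D_def by (intro image_eqI[of _ _ "u @ v"]) auto
  qed
  have one: "(\<lambda>_. 0, \<lambda>_. 0) \<in> D" unfolding D_def by (rule image_eqI[of _ _ "[]"]) auto
  have weval_D: "weval w \<in> D" if "w \<in> lists (UNIV \<times> S)" for w
    unfolding D_def using that by (rule imageI)
  have X: "(unit_vec i, \<lambda>_. 0) \<in> D" "(\<lambda>j. - unit_vec i j, \<lambda>_. 0) \<in> D" if i: "i \<in> V" for i
  proof -
    have "weval [(True, GX i)] = (unit_vec i, \<lambda>_. 0)" using i by (simp add: geval_def)
    moreover have "weval [(False, GX i)] = (\<lambda>j. - unit_vec i j, \<lambda>_. 0)" using i by (simp add: inv_geval)
    ultimately show "(unit_vec i, \<lambda>_. 0) \<in> D" "(\<lambda>j. - unit_vec i j, \<lambda>_. 0) \<in> D"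
      using weval_D[of "[(True, GX i)]"] weval_D[of "[(False, GX i)]"] i by (simp_all add: S_eq)
  qed
  have Y: "(\<lambda>_. 0, unit_vec p) \<in> D" "(\<lambda>_. 0, \<lambda>q. - unit_vec p q) \<in> D" if p: "p \<in> P" for p
  proof -
    obtain i j where ij: "p = (i, j)" by (cases p)
    have "weval [(True, GY i j)] = (\<lambda>_. 0, unit_vec p)" using p ij by (simp add: geval_def)
    moreover have "weval [(False, GY i j)] = (\<lambda>_. 0, \<lambda>q. - unit_vec p q)" using p ij by (simp add: inv_geval)
    ultimately show "(\<lambda>_. 0, unit_vec p) \<in> D" "(\<lambda>_. 0, \<lambda>q. - unit_vec p q) \<in> D"
      using weval_D[of "[(True, GY i j)]"] weval_D[of "[(False, GY i j)]"] p ij by (simp_all add: S_eq)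
  qed
  have YD: "(\<lambda>_. 0, b) \<in> D" if "b \<in> carrier (lattice_group P)" for b
    using finite_P that
  proof (induction rule: lattice_group_induct)
    case zero
    show ?case by (rule one)
  next
    case (plus b p)
    show ?case using mult[OF plus(3) Y(1)[OF plus(2)]] by simp
  next
    case (minus b p)
    show ?case using mult[OF minus(3) Y(2)[OF minus(2)]] by simp
  qed
  have XD: "\<exists>b\<in>carrier (lattice_group P). (a, b) \<in> D" if "a \<in> carrier (lattice_group V)" for a
    using finV that
  proof (induction rule: lattice_group_induct)
    case zero
    show ?case using one by (intro bexI[of _ "\<lambda>_. 0"]) auto
  next
    case (plus a i)
    then obtain b where b: "b \<in> carrier (lattice_group P)" "(a, b) \<in> D" by blast
    show ?case using mult[OF b(2) X(1)[OF plus(2)]] b(1)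
      by (intro bexI[of _ "\<lambda>p. b p + of_bool (p \<in> P) * (a (snd p) * unit_vec i (fst p))"]) auto
  next
    case (minus a i)
    then obtain b where b: "b \<in> carrier (lattice_group P)" "(a, b) \<in> D" by blast
    show ?case using mult[OF b(2) X(2)[OF minus(2)]] b(1)
      by (intro bexI[of _ "\<lambda>p. b p + of_bool (p \<in> P) * (a (snd p) * - unit_vec i (fst p))"]) auto
  qed
  obtain a b where k: "k = (a, b)" "a \<in> carrier (lattice_group V)" "b \<in> carrier (lattice_group P)"
    using assms by (cases k) (auto simp del: lattice_group_simps)
  obtain b' where b': "b' \<in> carrier (lattice_group P)" "(a, b') \<in> D" using XD[OF k(2)] by blast
  have "(\<lambda>_. 0, \<lambda>p. b p - b' p) \<in> D" using k(3) b'(1) by (intro YD) simp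
  from mult[OF b'(2) this] have "k \<in> D" by (simp add: k)
  then show ?thesis by (auto simp: D_def)
qed

lemma fst_weval: "i \<in> V \<Longrightarrow> w \<in> lists (UNIV \<times> S) \<Longrightarrow> fst (weval w) i = expsum (GX i) w"
proof (induction w)
  case (Cons l w)
  obtain b g where l: "l = (b, g)" by (cases l)
  have "g \<in> S" using Cons.prems l by simp
  then show ?case
    using Cons by (auto simp: l S_eq fst_nil2_mult inv_geval) (auto simp: geval_def)
qed simp

lemma weval_Y:
  "w \<in> lists (UNIV \<times> Y) \<Longrightarrow>
    weval w = (\<lambda>_. 0, \<lambda>(i, j). if (i, j) \<in> P then expsum (GY i j) w else 0)"
proof (induction w)
  case (Cons l w)
  then obtain b i j where l: "l = (b, GY i j)" and ij: "(i, j) \<in> P" by (cases l) auto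
  have IH: "weval w = (\<lambda>_. 0, \<lambda>(i, j). if (i, j) \<in> P then expsum (GY i j) w else 0)"
    using Cons by simp
  have "(if b then geval (GY i j) else inv\<^bsub>K\<^esub> (geval (GY i j))) =
      (\<lambda>_. 0, \<lambda>p. (if b then 1 else -1) * unit_vec (i, j) p)"
    using inv_geval(2)[OF ij] ij by (cases b) (simp_all add: geval_def fun_eq_iff)
  then show ?case using ij by (simp add: l IH fun_eq_iff del: group.inv_closed)
qed (auto simp: fun_eq_iff)

section \<open>Words in the presented group, first modulo the \<open>y\<close> and then
  exactly\<close>

sublocale words: word_congruence S "pres_eq S R"
  by (rule pres_eq_word_congruence) simp

lemma rel_trivial: "r \<in> R \<Longrightarrow> pres_eq S R r []"
  using pe_rel[of r R S "[]" "[]"] by simp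

lemma commute_XX:
  assumes "i \<in> V" "j \<in> V" "E i j"
  shows "pres_eq S R [(True, GX j), (True, GX i)] [(True, GX i), (True, GX j)]"
proof -
  have "comm_word [(True, GX j)] [(True, GX i)] \<in> R"
    using assms unfolding GGamma_rels_def by blast
  then show ?thesis
    using words.commutator_relation[of "GX j" "GX i" "[]"] rel_trivial assms by (simp add: S_eq)
qed

lemma commutator_XX:
  assumes "(i, j) \<in> P"
  shows "pres_eq S R [(True, GX j), (True, GX i), (False, GY i j)] [(True, GX i), (True, GX j)]"
proof -
  have "comm_word [(True, GX j)] [(True, GX i)] @ [(False, GY i j)] \<in> R"
    using assms unfolding GGamma_rels_def nonedges_def by blast
  moreover have "i \<in> V" "j \<in> V" using assms by (auto simp: nonedges_def)
  ultimately show ?thesis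
    using words.commutator_relation[of "GX j" "GX i" "[(False, GY i j)]"] rel_trivial assms
    by (simp add: S_eq)
qed

lemma commute_XY:
  assumes "l \<in> V" "(i, j) \<in> P"
  shows "pres_eq S R [(b, GX l), (d, GY i j)] [(d, GY i j), (b, GX l)]"
proof -
  have "comm_word [(True, GX l)] [(True, GY i j)] \<in> R"
    using assms unfolding GGamma_rels_def nonedges_def by blast
  then have "pres_eq S R [(True, GX l), (True, GY i j)] [(True, GY i j), (True, GX l)]"
    using words.commutator_relation[of "GX l" "GY i j" "[]"] rel_trivial assms by (simp add: S_eq)
  then show ?thesis by (rule words.commute_signs[rotated 2]) (use assms in \<open>auto simp: S_eq\<close>)
qed

text \<open>No relator concerns two of the \<open>y\<close>. The inverse of \<open>y_kl\<close>
  equals a commutator word in \<open>x_k\<close> and \<open>x_l\<close>, and \<open>y_ij\<close>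
  commutes with each of its letters.\<close>

lemma commute_YY:
  assumes ij: "(i, j) \<in> P" and kl: "(k, l) \<in> P"
  shows "pres_eq S R [(b, GY i j), (d, GY k l)] [(d, GY k l), (b, GY i j)]"
proof -
  let ?y = "(True, GY i j)" and ?z = "(False, GY k l)"
  let ?X = "[(False, GX k), (False, GX l), (True, GX k), (True, GX l)]"
  have kl': "k \<in> V" "l \<in> V" using kl by (auto simp: nonedges_def)
  have z: "pres_eq S R [?z] ?X"
  proof -
    have "pres_eq S R [(False, GX k), (False, GX l), (True, GX l), (True, GX k), ?z] ?X"
      using words.cong[OF commutator_XX[OF kl], of "[(False, GX k), (False, GX l)]" "[]"] kl'
      by (simp add: S_eq)
    moreover have "pres_eq S R [(False, GX k), (False, GX l), (True, GX l), (True, GX k), ?z]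
        [(False, GX k), (True, GX k), ?z]"
      using words.cancel_mid[of "GX l" "[(False, GX k)]" "[(True, GX k), ?z]" False] kl kl'
      by (simp add: S_eq)
    moreover have "pres_eq S R [(False, GX k), (True, GX k), ?z] [?z]"
      using words.cancel_mid[of "GX k" "[]" "[?z]" False] kl kl' by (simp add: S_eq)
    ultimately show ?thesis using pe_trans pe_sym by blast
  qed
  have "pres_eq S R [?y, ?z] (?y # ?X)"
    using pres_eq_append[OF z, of "[?y]" "[]"] by simp
  also have "pres_eq S R \<dots> (?X @ [?y])"
    by (rule words.commute_word) (use ij kl' commute_XY[OF _ ij] in \<open>auto simp: S_eq intro: pe_sym\<close>)
  also have "pres_eq S R \<dots> [?z, ?y]"
    using pres_eq_append[OF pe_sym[OF z], of "[]" "[?y]"] by simp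
  finally have yz: "pres_eq S R [?y, ?z] [?z, ?y]" .
  have "pres_eq S R [(True, GY k l), ?y] [?y, (True, GY k l)]"
    using words.commute_inverse[of "GY k l" ?y False] pe_sym[OF yz] ij kl by (auto simp: S_eq)
  from pe_sym[OF this] show ?thesis
    by (rule words.commute_signs[rotated 2]) (use ij kl in \<open>auto simp: S_eq\<close>)
qed

lemma commute_Y:
  assumes "l \<in> UNIV \<times> Y" "m \<in> UNIV \<times> S"
  shows "pres_eq S R [l, m] [m, l]"
proof -
  obtain b i j where l: "l = (b, GY i j)" "(i, j) \<in> P" using assms(1) by auto
  obtain d g where m: "m = (d, g)" "g \<in> S" using assms(2) by (cases m) auto
  consider k where "g = GX k" "k \<in> V" | k n where "g = GY k n" "(k, n) \<in> P"
    using m(2) by (auto simp: S_eq)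
  then show ?thesis
    using commute_XY[OF _ l(2)] commute_YY[OF l(2)] unfolding l(1) m(1) by cases (simp_all add: pe_sym)
qed

text \<open>Equality in the quotient by the subgroup generated by the \<open>y\<close>, phrased with
  an explicit word \<open>c\<close> so that an equation in the presented group can be
  recovered.\<close>

definition eq_mod_Y :: "gen word \<Rightarrow> gen word \<Rightarrow> bool" where
  "eq_mod_Y u v \<longleftrightarrow> u \<in> words.L \<and> v \<in> words.L \<and> (\<exists>c\<in>lists (UNIV \<times> Y). pres_eq S R u (v @ c))"

lemma Y_subset: "c \<in> lists (UNIV \<times> Y) \<Longrightarrow> c \<in> words.L"
  by (auto simp: S_eq)

text \<open>Compatibility with concatenation holds because the \<open>y\<close> are central: the
  correcting word \<open>c\<close> moves past \<open>q\<close> to the end.\<close>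

sublocale mod_Y: word_congruence S eq_mod_Y
proof
  show "eq_mod_Y w w" if "w \<in> words.L" for w
    using that pe_refl by (auto simp: eq_mod_Y_def intro!: bexI[of _ "[]"])
  show "eq_mod_Y v u" if uv: "eq_mod_Y u v" for u v
  proof -
    obtain c where c: "u \<in> words.L" "v \<in> words.L" "c \<in> lists (UNIV \<times> Y)" "pres_eq S R u (v @ c)"
      using uv by (auto simp: eq_mod_Y_def)
    have inv: "word_inv c \<in> lists (UNIV \<times> Y)" using c(3) by (force simp: word_inv_def)
    have "pres_eq S R (u @ word_inv c) (v @ c @ word_inv c)"
      using pres_eq_append[OF c(4), of "[]" "word_inv c"] by simp
    moreover have "pres_eq S R (v @ c @ word_inv c) v"
      using pres_eq_append[OF words.word_inv_right[OF Y_subset[OF c(3)]], of v "[]"] by simp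
    ultimately have "pres_eq S R v (u @ word_inv c)" using pe_sym pe_trans by blast
    then show ?thesis
      using c(1,2) inv unfolding eq_mod_Y_def by (intro conjI bexI[of _ "word_inv c"])
  qed
  show "eq_mod_Y u w" if uv: "eq_mod_Y u v" and vw: "eq_mod_Y v w" for u v w
  proof -
    obtain c d where c: "c \<in> lists (UNIV \<times> Y)" "pres_eq S R u (v @ c)"
      and d: "d \<in> lists (UNIV \<times> Y)" "pres_eq S R v (w @ d)"
      using uv vw by (auto simp: eq_mod_Y_def)
    have "pres_eq S R u (w @ d @ c)"
      using pe_trans[OF c(2)] pres_eq_append[OF d(2), of "[]" c] by simp
    then show ?thesis using uv vw c(1) d(1) unfolding eq_mod_Y_def
      by (intro conjI bexI[of _ "d @ c"]) auto
  qed
  show "eq_mod_Y (p @ u @ q) (p @ v @ q)"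
    if uv: "eq_mod_Y u v" and p: "p \<in> words.L" and q: "q \<in> words.L" for u v p q
  proof -
    obtain c where c: "u \<in> words.L" "v \<in> words.L" "c \<in> lists (UNIV \<times> Y)" "pres_eq S R u (v @ c)"
      using uv by (auto simp: eq_mod_Y_def)
    have "pres_eq S R (c @ q) (q @ c)"
      by (rule words.commute_words[OF Y_subset[OF c(3)] q])
        (rule commute_Y; use c(3) q in blast)
    from pres_eq_append[OF this, of "p @ v" "[]"] have "pres_eq S R (p @ v @ c @ q) ((p @ v @ q) @ c)"
      by simp
    moreover have "pres_eq S R (p @ u @ q) (p @ v @ c @ q)"
      using pres_eq_append[OF c(4), of p q] by simp
    ultimately have "pres_eq S R (p @ u @ q) ((p @ v @ q) @ c)" using pe_trans by blast
    then show ?thesis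
      using c(1-3) p q unfolding eq_mod_Y_def by (intro conjI bexI[of _ c]) auto
  qed
  show "eq_mod_Y [(b, g), (\<not> b, g)] []" if "g \<in> S" for b g
    using words.cancel[OF that] that by (auto simp: eq_mod_Y_def intro!: bexI[of _ "[]"])
qed

text \<open>Modulo the \<open>y\<close> the relators for nonadjacent vertices become commutation
  relations too, so all letters commute.\<close>

lemma mod_Y_commute:
  assumes "l \<in> UNIV \<times> S" "m \<in> UNIV \<times> S"
  shows "eq_mod_Y [l, m] [m, l]"
proof -
  have of_eq: "eq_mod_Y u v" if "pres_eq S R u v" "u \<in> words.L" "v \<in> words.L" for u v
    using that by (auto simp: eq_mod_Y_def intro!: bexI[of _ "[]"])
  obtain b g where l: "l = (b, g)" "g \<in> S" using assms(1) by (cases l) auto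
  obtain d h where m: "m = (d, h)" "h \<in> S" using assms(2) by (cases m) auto
  consider "g \<in> Y" | "h \<in> Y" | i j where "g = GX i" "h = GX j" "i \<in> V" "j \<in> V"
    using l m by (auto simp: S_eq)
  then show ?thesis
  proof cases
    case 1
    then show ?thesis using commute_Y[of l m] l(1) assms by (intro of_eq) auto
  next
    case 2
    then show ?thesis using commute_Y[of m l] m(1) assms by (intro of_eq) (auto intro: pe_sym)
  next
    case 3
    have nonedge: "eq_mod_Y [(True, GX i), (True, GX j)] [(True, GX j), (True, GX i)]"
      if "(i, j) \<in> P" for i j
      using pe_sym[OF commutator_XX[OF that]] that unfolding eq_mod_Y_def
      by (auto simp: S_eq nonedges_def intro!: bexI[of _ "[(False, GY i j)]"])
    have "eq_mod_Y [(True, GX i), (True, GX j)] [(True, GX j), (True, GX i)]"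
    proof (cases "i = j \<or> E i j")
      case True
      then show ?thesis
        using 3 commute_XX[of j i] E_sym by (intro of_eq) (auto simp: S_eq intro: pe_refl)
    next
      case False
      then have "(i, j) \<in> P \<or> (j, i) \<in> P" using 3 E_sym by (auto simp: nonedges_def)
      then show ?thesis using nonedge mod_Y.sym by blast
    qed
    then show ?thesis
      unfolding l(1) m(1) 3(1,2) by (rule mod_Y.commute_signs[rotated 2]) (use 3 in \<open>auto simp: S_eq\<close>)
  qed
qed

text \<open>Two stages. The first component of \<open>weval w\<close> gives the exponent sums of the
  \<open>x\<close>; they vanish, so \<open>w\<close> reduces to a word \<open>c\<close> in the
  \<open>y\<close>. Then \<open>weval c\<close> gives the exponent sums of the \<open>y\<close>, and
  \<open>c\<close> reduces to the empty word.\<close>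

lemma weval_inj:
  assumes w: "w \<in> lists (UNIV \<times> S)" "weval w = \<one>\<^bsub>K\<^esub>"
  shows "pres_eq S R w []"
proof -
  have "eq_mod_Y w []"
  proof (rule mod_Y.trivial_of_expsum_zero[where T = Y, OF mod_Y_commute _ w(1)])
    show "eq_mod_Y [(b, g)] []" if "g \<in> Y" for b g
      using that unfolding eq_mod_Y_def by (intro conjI bexI[of _ "[(b, g)]"]) (auto simp: S_eq intro: pe_refl)
    show "expsum g w = 0" if "g \<in> S - Y" for g
      using that fst_weval[OF _ w(1)] w(2) by (auto simp: S_eq)
  qed
  then obtain c where c: "c \<in> lists (UNIV \<times> Y)" "pres_eq S R w c" by (auto simp: eq_mod_Y_def)
  have "weval c = \<one>\<^bsub>K\<^esub>" using weval_pres_eq[OF c(2) weval_relator] w(2) by simp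
  then have snd0: "snd (weval c) p = 0" for p by simp
  have exp0: "expsum g c = 0" if g: "g \<in> Y" for g
  proof -
    obtain i j where ij: "g = GY i j" "(i, j) \<in> P" using g by blast
    then show ?thesis using snd0[of "(i, j)"] by (simp add: weval_Y[OF c(1)])
  qed
  interpret Y: word_congruence Y "pres_eq S R"
    by (rule pres_eq_word_congruence) (auto simp: S_eq)
  have "pres_eq S R c []"
    by (rule Y.trivial_of_expsum_zero[where T = "{}", OF commute_Y])
      (use c(1) exp0 in \<open>auto simp: S_eq\<close>)
  with c(2) show ?thesis by (rule pe_trans)
qed

lemma spec_R_GGamma: "spec_R (GGamma V E) = spec_R K"
  using spec_R_cong_iso[OF group_nil2 presented_group_iso(2,1)[OF weval_relator weval_surj weval_inj]]
  unfolding GGamma_def by simp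

end

section \<open>From the graph to the split model\<close>

lemma spec_R_GGamma_split:
  assumes "finite V" "\<And>i j. E i j \<Longrightarrow> E j i" "\<And>i. \<not> E i i"
    and U: "U = {v \<in> V. graph_degree V E v = card V - 1}"
  shows "spec_R (GGamma V E) = set_times_inf (spec_R (Zpow (card U))) (spec_R (GGamma (V - U) E))"
proof -
  have U_iff: "v \<in> U \<longleftrightarrow> (\<forall>u\<in>V. u \<noteq> v \<longrightarrow> E v u)" if v: "v \<in> V" for v
  proof -
    have sub: "{u \<in> V. E v u} \<subseteq> V - {v}" using assms(3) by auto
    \<comment> \<open>Since \<open>v \<in> V\<close>, the subtraction in \<open>card V - 1\<close>
      is not truncated and equals \<open>card (V - {v})\<close>.\<close>
    have "v \<in> U \<longleftrightarrow> card {u \<in> V. E v u} = card (V - {v})"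
      using v assms(1) by (simp add: U graph_degree_def)
    also have "\<dots> \<longleftrightarrow> {u \<in> V. E v u} = V - {v}"
      using card_subset_eq[OF finite_Diff[OF assms(1)] sub] by (rule iffI) simp_all
    also have "\<dots> \<longleftrightarrow> (\<forall>u\<in>V. u \<noteq> v \<longrightarrow> E v u)" using assms(3) by auto
    finally show ?thesis .
  qed
  have UV: "U \<subseteq> V" by (auto simp: U)
  \<comment> \<open>Vertices in \<open>U\<close> are joined to all others, so no nonedge meets
    \<open>U\<close> and both groups have the same \<open>y\<close>.\<close>
  have P: "nonedges V E = nonedges (V - U) E"
    using U_iff assms(2) by (fastforce simp: nonedges_def)
  interpret V: graph V E using assms by unfold_locales
  interpret W: graph "V - U" E using assms by unfold_locales auto
  interpret central_split U "V - U" "nonedges (V - U) E"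
  proof
    fix w assume w: "w \<in> V - U"
    then obtain u where u: "u \<in> V" "u \<noteq> w" "\<not> E w u" using U_iff by blast
    \<comment> \<open>The vertex \<open>u\<close> witnessing that \<open>w\<close> is not in
      \<open>U\<close> must itself lie outside \<open>U\<close>, for otherwise symmetry would join
      it to \<open>w\<close>.\<close>
    have "u \<notin> U"
    proof
      assume "u \<in> U"
      then have "E u w" using U_iff[OF u(1)] w u(2) by auto
      then show False using assms(2) u(3) by blast
    qed
    then show "\<exists>u. (w, u) \<in> nonedges (V - U) E \<or> (u, w) \<in> nonedges (V - U) E"
      using w u assms(2) by (intro exI[of _ u]) (auto simp: nonedges_def)
  qed (use assms(1) finite_subset[OF UV assms(1)] in \<open>auto simp: nonedges_def\<close>)
  have "U \<union> (V - U) = V" using UV by auto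
  then have "spec_R (GGamma V E) = spec_R G" using V.spec_R_GGamma P by simp
  also have "\<dots> = set_times_inf (spec_R (lattice_group U)) (spec_R H)" by (rule spec_R_nil2)
  also have "spec_R H = spec_R (GGamma (V - U) E)" using W.spec_R_GGamma by simp
  also have "spec_R (lattice_group U) = spec_R (Zpow (card U))" using spec_R_Zpow[OF finU] by simp
  finally show ?thesis .
qed

theorem theorem5p6:
  fixes n :: nat and E :: "nat \<Rightarrow> nat \<Rightarrow> bool"
  assumes sym: "\<And>i j. E i j \<Longrightarrow> E j i"
    and irrefl: "\<And>i. \<not> E i i"
    and verts: "\<And>i j. E i j \<Longrightarrow> i < n \<and> j < n"
    and r_lt: "card {v \<in> {..<n}. graph_degree {..<n} E v = n - 1} < n"
  shows "spec_R (GGamma {..<n} E) =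
           set_times_inf (spec_R (Zpow (card {v \<in> {..<n}. graph_degree {..<n} E v = n - 1})))
                         (spec_R (GGamma ({..<n} - {v \<in> {..<n}. graph_degree {..<n} E v = n - 1}) E))"
  using sym irrefl by (intro spec_R_GGamma_split) auto

end
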